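(* Let $p$ be a prime number and let $G$ be a finite group. Let $N$ be a nilpotent normal subgroup of $G$ such that $G/N$ is nilpotent. If the Sylow $p$-subgroup of $N$ is abelian and the Sylow $p$-subgroup of $G/N$ is cyclic, then every automorphism of $G$ of order a power of $p$ which is both class-preserving and a Coleman automorphism is inner.
   Context: An automorphism $\sigma$ of a finite group $G$ is a Coleman automorphism if for any prime $\ell$ dividing $|G|$ and any Sylow $\ell$-subgroup $P$ of $G$ there exists $g\in G$ such that $\sigma|_P=\mathrm{conj}(g)|_P$, where $\mathrm{conj}(g)$ is the map $x\mapsto g^{-1}xg$. An automorphism $\sigma$ of $G$ is class-preserving if for any $g\in G$ there exists $x\in G$ with $\sigma(g)=x^{-1}gx$. *)

theory Defs
  imports "HOL-Algebra.Algebra"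
begin

text \<open>Automorphisms are elements of \<^term>\<open>auto G\<close>, i.e. extensional functions, so that equality of
  automorphisms is HOL equality and orders can be taken in \<^term>\<open>AutoGroup G\<close>.
  A subgroup \<open>H\<close> of \<open>G\<close> is viewed as a group as \<open>G\<lparr>carrier := H\<rparr>\<close>.\<close>

definition conj_map :: "('a, 'b) monoid_scheme \<Rightarrow> 'a \<Rightarrow> 'a \<Rightarrow> 'a" where
  "conj_map G g = (\<lambda>x\<in>carrier G. inv\<^bsub>G\<^esub> g \<otimes>\<^bsub>G\<^esub> x \<otimes>\<^bsub>G\<^esub> g)"

definition inner_automorphism :: "('a, 'b) monoid_scheme \<Rightarrow> ('a \<Rightarrow> 'a) \<Rightarrow> bool" where
  "inner_automorphism G \<sigma> \<longleftrightarrow> (\<exists>g\<in>carrier G. \<sigma> = conj_map G g)"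

text \<open>If \<open>p\<close> does not divide the order of \<open>G\<close>, the Sylow \<open>p\<close>-subgroup is the trivial subgroup.\<close>

definition sylow_subgroup :: "('a, 'b) monoid_scheme \<Rightarrow> nat \<Rightarrow> 'a set \<Rightarrow> bool" where
  "sylow_subgroup G p P \<longleftrightarrow> subgroup P G \<and> card P = p ^ multiplicity p (order G)"

definition class_preserving_automorphism ::
    "('a, 'b) monoid_scheme \<Rightarrow> ('a \<Rightarrow> 'a) \<Rightarrow> bool" where
  "class_preserving_automorphism G \<sigma> \<longleftrightarrow> \<sigma> \<in> auto G \<and>
     (\<forall>g\<in>carrier G. \<exists>x\<in>carrier G. \<sigma> g = inv\<^bsub>G\<^esub> x \<otimes>\<^bsub>G\<^esub> g \<otimes>\<^bsub>G\<^esub> x)"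

definition coleman_automorphism :: "('a, 'b) monoid_scheme \<Rightarrow> ('a \<Rightarrow> 'a) \<Rightarrow> bool" where
  "coleman_automorphism G \<sigma> \<longleftrightarrow> \<sigma> \<in> auto G \<and>
     (\<forall>l P. Factorial_Ring.prime l \<longrightarrow> l dvd order G \<longrightarrow> sylow_subgroup G l P \<longrightarrow>
        (\<exists>g\<in>carrier G. restrict \<sigma> P = restrict (conj_map G g) P))"

text \<open>The lower central series, starting at index 0 with the whole group.\<close>

primrec lower_central :: "('a, 'b) monoid_scheme \<Rightarrow> nat \<Rightarrow> 'a set" where
  "lower_central G 0 = carrier G"
| "lower_central G (Suc n) = generate G
     {inv\<^bsub>G\<^esub> x \<otimes>\<^bsub>G\<^esub> inv\<^bsub>G\<^esub> y \<otimes>\<^bsub>G\<^esub> x \<otimes>\<^bsub>G\<^esub> y | x y. x \<in> lower_central G n \<and> y \<in> carrier G}"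

definition nilpotent_group :: "('a, 'b) monoid_scheme \<Rightarrow> bool" where
  "nilpotent_group G \<longleftrightarrow> group G \<and> (\<exists>n. lower_central G n = {\<one>\<^bsub>G\<^esub>})"

end

theory Submission
  imports Defs "HOL-Number_Theory.Cong"
begin

text \<open>Following \<open>\<sigma>\<close> by a conjugation affects neither class preservation nor the Coleman property nor being inner.
By the Coleman property a suitable conjugation makes \<open>\<sigma>\<close> fix a Sylow \<open>p\<close>-subgroup \<open>S\<close> of \<open>G\<close>
pointwise, and it can be chosen so that the order remains a power of \<open>p\<close>
(\<open>normalise_on_subgroup\<close>); call the result \<open>f\<close>. The aim is to correct \<open>f\<close> by a further conjugation
until it fixes \<open>S\<close> and \<open>N\<close> pointwise and acts trivially on \<open>G/N\<close>. For such an automorphism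
\<open>g \<mapsto> inv g f(g)\<close> is a cocycle with values in the \<open>p\<close>-elements of the centre of \<open>N\<close>, vanishing on \<open>S\<close>.
Since the index of \<open>S\<close> is prime to \<open>p\<close>, averaging over the cosets of \<open>S\<close> shows that it is a
coboundary, which says that the automorphism is inner (\<open>inner_if_trivial_on_sylow\<close>).

Two facts about central series carry the rest. Modulo the end of a central series, elements of
coprime orders commute (\<open>coprime_commute_mod_chain\<close>), and an automorphism that preserves conjugacy
classes fixes every element whose order is coprime to that of the automorphism
(\<open>coprime_automorphism_mod_chain\<close>). As \<open>f\<close> also fixes \<open>S\<close>, the second fact shows that \<open>f\<close> acts
trivially on \<open>G/N\<close>.

The action on \<open>N\<close> is the heart of the matter. For \<open>s \<in> S\<close> let \<open>twist s\<close> be \<open>y \<mapsto> s f(y) (inv s)\<close>; an \<open>s\<close>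
is wanted for which this is the identity on \<open>N\<close>. By the second fact, and because \<open>S \<inter> N\<close> is central in
\<open>N\<close>, it suffices that \<open>twist s\<close> preserves the \<open>N\<close>-class of every element \<open>y\<close> of prime power order in
\<open>N\<close>. Given two such elements there is a \<open>u\<close>
with \<open>f\<close> equal to conjugation by \<open>u\<close> on both: for the same prime this is the Coleman property, for
different primes it follows from class preservation at their product. Writing \<open>u = h s\<close> with
\<open>s \<in> S\<close> and \<open>h\<close> of order prime to \<open>p\<close> modulo \<open>N\<close>, the map \<open>twist s\<close> acts on the two classes as \<open>h\<close>
does, and as it has \<open>p\<close>-power order it fixes both (\<open>twist_preserves_class\<close>). So the sets of good
\<open>s\<close> for the individual \<open>y\<close> meet pairwise. They are cosets of the stabilisers in \<open>S\<close> of the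
classes, and these stabilisers form a chain because \<open>S/(S \<inter> N)\<close> is cyclic. Hence all the cosets
have a common element (\<open>uniform_twist\<close>). As \<open>S \<inter> N\<close> is central in \<open>N\<close>, this element can be taken to be a
power of a generator of \<open>S\<close> modulo \<open>N\<close>. It then commutes with that generator, and it centralises
\<open>S \<inter> N\<close> because both \<open>f\<close> and \<open>twist s\<close> fix this subgroup pointwise; so it centralises \<open>S\<close>,
\<open>twist s\<close> still fixes \<open>S\<close> pointwise, and the averaging argument applies to it.\<close>

section \<open>Commuting elements, powers and cosets\<close>

lemma (in group) mult_inv_cancel_left:
  assumes "x \<in> carrier G" "z \<in> carrier G"
  shows "x \<otimes> (inv x \<otimes> z) = z" "inv x \<otimes> (x \<otimes> z) = z"
  using assms by (simp_all add: m_assoc[symmetric])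

lemma (in group) commute_inv:
  assumes "x \<in> carrier G" "y \<in> carrier G" "x \<otimes> y = y \<otimes> x"
  shows "x \<otimes> inv y = inv y \<otimes> x"
proof -
  have "inv y \<otimes> (x \<otimes> y) \<otimes> inv y = inv y \<otimes> (y \<otimes> x) \<otimes> inv y" using assms(3) by simp
  then show ?thesis using assms(1,2) by (simp add: m_assoc mult_inv_cancel_left)
qed

lemma (in group) commute_mult:
  assumes "x \<in> carrier G" "y \<in> carrier G" "z \<in> carrier G" "x \<otimes> y = y \<otimes> x" "x \<otimes> z = z \<otimes> x"
  shows "x \<otimes> (y \<otimes> z) = (y \<otimes> z) \<otimes> x"
proof -
  have "x \<otimes> (y \<otimes> z) = (y \<otimes> x) \<otimes> z" using assms(1-4) by (simp add: m_assoc[symmetric])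
  also have "\<dots> = y \<otimes> (z \<otimes> x)" using assms(1-3,5) by (simp add: m_assoc)
  finally show ?thesis using assms(1-3) by (simp add: m_assoc)
qed

lemma (in group) coprime_pow_eq_one:
  assumes "x \<in> carrier G" "x [^] (m::nat) = \<one>" "x [^] (k::nat) = \<one>" "coprime m k"
  shows "x = \<one>"
  using assms by (metis coprime_common_divisor nat_dvd_1_iff_1 ord_eq_1 pow_eq_id)

lemma (in group) conj_nat_pow:
  assumes "x \<in> carrier G" "y \<in> carrier G"
  shows "(inv x \<otimes> y \<otimes> x) [^] (n::nat) = inv x \<otimes> y [^] n \<otimes> x"
proof (induction n)
  case 0
  then show ?case using assms by simp
next
  case (Suc n)
  show ?case using Suc assms by (simp add: m_assoc mult_inv_cancel_left)
qed

lemma (in group) pow_cong: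
  assumes "x \<in> carrier G" "x [^] (n::nat) = \<one>" "[i = j] (mod n)"
  shows "x [^] (i::nat) = x [^] j"
proof -
  have "ord x dvd n" using assms pow_eq_id by blast
  hence "[i = j] (mod ord x)" using assms(3) cong_dvd_modulus_nat by blast
  hence "int (ord x) dvd int j - int i"
    by (metis cong_iff_dvd_diff cong_int_iff cong_sym)
  then have "x [^] int i = x [^] int j" using int_pow_eq[OF assms(1)] by blast
  then show ?thesis by (simp add: int_pow_int)
qed

text \<open>The exponent of the \<open>p\<close>-part \<open>a\<close>, a power of \<open>g\<close>, comes from the Chinese remainder theorem.\<close>

lemma (in group) primary_decomposition:
  assumes fin: "finite (carrier G)" and p: "Factorial_Ring.prime (p::nat)" and g: "g \<in> carrier G"
  obtains a b k m where "a \<in> carrier G" "b \<in> carrier G" "g = b \<otimes> a"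
    "a [^] (p ^ k) = \<one>" "b [^] m = \<one>" "coprime p m"
proof -
  define k where "k = multiplicity p (order G)"
  have o: "order G \<noteq> 0" using fin g by (auto simp: order_def)
  obtain m where m: "order G = p ^ k * m" "\<not> p dvd m"
    using multiplicity_decompose'[of "order G" p] o p
    by (metis k_def not_prime_unit)
  have cop: "coprime p m" using m(2) p by (simp add: prime_imp_coprime)
  have g1: "g [^] (p ^ k * m) = \<one>" using pow_order_eq_1[OF g] m(1) by simp
  obtain e where e: "[e = 1] (mod p ^ k)" "[e = 0] (mod m)"
    using binary_chinese_remainder_nat[of "p ^ k" m 1 0] cop by auto
  define a where "a = g [^] e"
  define b where "b = g \<otimes> inv a"
  have ac: "a \<in> carrier G" "b \<in> carrier G" using g by (auto simp: a_def b_def)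
  have "[e * p ^ k = 0] (mod p ^ k * m)" using e(2) by (simp add: cong_0_iff mult.commute)
  then have a1: "a [^] (p ^ k) = \<one>"
    unfolding a_def using pow_cong[OF g g1] g by (metis nat_pow_0 nat_pow_pow)
  have "[e * m = m] (mod p ^ k * m)" using e(1)
    by (metis cong_cmult_rightI nat_mult_1)
  then have a2: "a [^] m = g [^] m"
    unfolding a_def using pow_cong[OF g g1] g by (metis nat_pow_pow)
  have comm: "g \<otimes> inv a = inv a \<otimes> g"
  proof -
    have "a \<otimes> g = g \<otimes> a" unfolding a_def using g nat_pow_comm[of g e 1] by simp
    then show ?thesis using commute_inv[OF g ac(1)] by simp
  qed
  have "b [^] m = g [^] m \<otimes> inv (a [^] m)"
    unfolding b_def using pow_mult_distrib[OF comm] g ac nat_pow_inv by auto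
  then have b1: "b [^] m = \<one>" using a2 g by simp
  have "g = b \<otimes> a" unfolding b_def using g ac by (simp add: m_assoc)
  then show ?thesis using that ac a1 b1 cop by blast
qed

lemma (in normal) rcos_eq_iff:
  assumes "x \<in> carrier G" "y \<in> carrier G"
  shows "H #> x = H #> y \<longleftrightarrow> inv x \<otimes> y \<in> H"
proof -
  have "H #> x = H #> y \<longleftrightarrow> x <# H = y <# H"
    using assms coset_eq by auto
  also have "\<dots> \<longleftrightarrow> y \<in> x <# H"
    using assms l_repr_independence[OF _ _ is_subgroup] lcos_self[OF _ is_subgroup] by metis
  also have "\<dots> \<longleftrightarrow> inv x \<otimes> y \<in> H"
    using lcos_module_imp[OF is_group assms(1), of y] lcos_module_rev[OF is_group assms(1,2)] by blast
  finally show ?thesis .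
qed

lemma (in normal) rcos_eq_one_iff:
  assumes "x \<in> carrier G"
  shows "H #> x = \<one>\<^bsub>G Mod H\<^esub> \<longleftrightarrow> x \<in> H"
  using assms by (metis coset_join1 coset_join2 is_subgroup one_FactGroup subset)

lemma (in normal) quotient_hom: "group_hom G (G Mod H) (\<lambda>x. H #> x)"
  by (simp add: factorgroup_is_group group_hom.intro group_hom_axioms.intro r_coset_hom_Mod)

text \<open>If the commutator \<open>c\<close> commutes with \<open>a\<close> and \<open>b\<close>, then conjugation by \<open>b\<close> multiplies \<open>a\<close> by \<open>c\<close>, so
\<open>c\<close> inherits the exponent of \<open>a\<close>. By symmetry it also inherits that of \<open>b\<close>.\<close>

lemma (in group) commutator_eq_one_coprime:
  assumes c: "a \<in> carrier G" "b \<in> carrier G" "c \<in> carrier G" "inv a \<otimes> inv b \<otimes> a \<otimes> b = c"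
    and ca: "a \<otimes> c = c \<otimes> a" and cb: "b \<otimes> c = c \<otimes> b"
    and a: "a [^] (m::nat) = \<one>" and b: "b [^] (k::nat) = \<one>" and cop: "coprime m k"
  shows "c = \<one>"
proof -
  have "inv b \<otimes> a \<otimes> b = a \<otimes> c" using c(1,2) c(4)[symmetric] 
    by (simp add: m_assoc[symmetric])
  then have "(a \<otimes> c) [^] m = \<one>" using conj_nat_pow[of b a m] c a by simp
  then have cm: "c [^] m = \<one>" using pow_mult_distrib[OF ca] c a by simp
  have "inv a \<otimes> inv b \<otimes> a = c \<otimes> inv b" using c(1,2) c(4)[symmetric] 
    by (simp add: m_assoc)
  then have "(c \<otimes> inv b) [^] k = \<one>" using conj_nat_pow[of a "inv b" k] c b nat_pow_inv by simp
  moreover have "c \<otimes> inv b = inv b \<otimes> c"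
    using commute_inv[OF c(3,2)] cb by simp
  ultimately have "c [^] k = \<one>" using pow_mult_distrib[of c "inv b" k] c b nat_pow_inv by simp
  then show ?thesis using coprime_pow_eq_one cm cop c by blast
qed

text \<open>Cyclic groups are described by integer exponents, whereas the homomorphism rules used below are
those for natural exponents.\<close>

lemma (in group) int_pow_eq_nat_pow:
  assumes "finite (carrier G)" "x \<in> carrier G"
  obtains j :: nat where "x [^] (i::int) = x [^] j"
proof -
  have o: "0 < order G" using assms(1) order_gt_0_iff_finite by blast
  have "int (ord x) dvd int (order G)" using ord_dvd_group_order[OF assms(2)] by simp
  then have "int (ord x) dvd int (nat (i mod int (order G))) - i"
    using o by (metis dvd_minus_mod dvd_trans int_nat_eq dvd_diff_commute mod_eq_dvd_iff mod_mod_trivial pos_mod_sign of_nat_0_less_iff)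
  then have "x [^] i = x [^] int (nat (i mod int (order G)))" using int_pow_eq[OF assms(2)] by blast
  then show ?thesis using that unfolding int_pow_int by blast
qed

text \<open>Both divisors are powers of \<open>p\<close>. This is the arithmetic behind the fact that the subgroups of a
cyclic \<open>p\<close>-group form a chain.\<close>

lemma prime_power_gcd_linear:
  assumes "Factorial_Ring.prime (p::nat)"
  shows "gcd i (p ^ a) dvd j \<or> gcd j (p ^ a) dvd i"
proof -
  obtain b where b: "gcd i (p ^ a) = p ^ b" using divides_primepow_nat[OF assms] gcd_dvd2 by blast
  obtain c where c: "gcd j (p ^ a) = p ^ c" using divides_primepow_nat[OF assms] gcd_dvd2 by blast
  have "p ^ b dvd i" "p ^ c dvd j" using b c by (metis gcd_dvd1)+
  then show ?thesis using b c le_imp_power_dvd by (metis dvd_trans nle_le)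
qed

section \<open>Central series and coprimality\<close>

lemma (in group) subgroup_nat_pow_closed:
  assumes "subgroup H G" "x \<in> H"
  shows "x [^] (n::nat) \<in> H"
  by (induction n) (use assms in \<open>auto simp: subgroup.one_closed subgroup.m_closed\<close>)

text \<open>A descending series that ends in \<open>L n\<close> rather than in the trivial subgroup: with
\<open>L n = N\<close> this expresses that \<open>G/N\<close> is nilpotent while all computations stay inside \<open>G\<close>.\<close>

definition central_chain :: "('a, 'b) monoid_scheme \<Rightarrow> (nat \<Rightarrow> 'a set) \<Rightarrow> nat \<Rightarrow> bool" where
  "central_chain G L n \<longleftrightarrow> L 0 = carrier G \<and> (\<forall>i\<le>n. L i \<lhd> G \<and> L n \<subseteq> L i) \<and>
     (\<forall>i<n. \<forall>x\<in>L i. \<forall>y\<in>carrier G. inv\<^bsub>G\<^esub> x \<otimes>\<^bsub>G\<^esub> inv\<^bsub>G\<^esub> y \<otimes>\<^bsub>G\<^esub> x \<otimes>\<^bsub>G\<^esub> y \<in> L (Suc i))"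

lemma central_chainD:
  assumes "central_chain G L n"
  shows "L 0 = carrier G" "i \<le> n \<Longrightarrow> L i \<lhd> G" "i \<le> n \<Longrightarrow> L n \<subseteq> L i"
    "i < n \<Longrightarrow> x \<in> L i \<Longrightarrow> y \<in> carrier G \<Longrightarrow>
       inv\<^bsub>G\<^esub> x \<otimes>\<^bsub>G\<^esub> inv\<^bsub>G\<^esub> y \<otimes>\<^bsub>G\<^esub> x \<otimes>\<^bsub>G\<^esub> y \<in> L (Suc i)"
  using assms by (auto simp: central_chain_def)

lemma (in normal) rcos_commute_iff:
  assumes "x \<in> carrier G" "y \<in> carrier G"
  shows "(H #> x) \<otimes>\<^bsub>G Mod H\<^esub> (H #> y) = (H #> y) \<otimes>\<^bsub>G Mod H\<^esub> (H #> x)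
    \<longleftrightarrow> inv x \<otimes> inv y \<otimes> x \<otimes> y \<in> H"
proof -
  interpret q: group_hom G "G Mod H" "\<lambda>x. H #> x" by (rule quotient_hom)
  have "(H #> y) \<otimes>\<^bsub>G Mod H\<^esub> (H #> x) = (H #> x) \<otimes>\<^bsub>G Mod H\<^esub> (H #> y)
      \<longleftrightarrow> H #> (y \<otimes> x) = H #> (x \<otimes> y)"
    using assms by (simp only: q.hom_mult)
  also have "\<dots> \<longleftrightarrow> inv (y \<otimes> x) \<otimes> (x \<otimes> y) \<in> H" using assms by (subst rcos_eq_iff) auto
  also have "inv (y \<otimes> x) \<otimes> (x \<otimes> y) = inv x \<otimes> inv y \<otimes> x \<otimes> y"
    using assms by (simp add: inv_mult_group m_assoc)
  finally show ?thesis by metis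
qed

text \<open>The commutator descends along the series: once it lies in \<open>L i\<close>, it is central modulo
\<open>L (i + 1)\<close>, and there its order divides both \<open>m\<close> and \<open>k\<close>.\<close>

lemma (in group) coprime_commute_mod_chain:
  assumes L: "central_chain G L n"
    and c: "a \<in> carrier G" "b \<in> carrier G" and a: "a [^] (m::nat) \<in> L n" and b: "b [^] (k::nat) \<in> L n"
    and cop: "coprime m k"
  shows "inv a \<otimes> inv b \<otimes> a \<otimes> b \<in> L n"
proof -
  define d where "d = inv a \<otimes> inv b \<otimes> a \<otimes> b"
  have dc: "d \<in> carrier G" using c by (simp add: d_def)
  have "d \<in> L i" if "i \<le> n" for i
    using that
  proof (induction i)
    case 0
    then show ?case using dc central_chainD(1)[OF L] by simp
  next
    case (Suc i)
    then have d: "d \<in> L i" and i: "i < n" by auto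
    interpret H: normal "L (Suc i)" G using central_chainD(2)[OF L] Suc by simp
    let ?f = "\<lambda>x. L (Suc i) #> x"
    interpret q: group_hom G "G Mod L (Suc i)" ?f by (rule H.quotient_hom)
    have one: "(?f x) [^]\<^bsub>G Mod L (Suc i)\<^esub> j = \<one>\<^bsub>G Mod L (Suc i)\<^esub>"
      if "x \<in> carrier G" "x [^] j \<in> L n" for x and j :: nat
      using that q.hom_nat_pow[of x j] central_chainD(3)[OF L Suc.prems] H.rcos_eq_one_iff[of "x [^] j"]
      by auto
    have "?f d = \<one>\<^bsub>G Mod L (Suc i)\<^esub>"
    proof (rule q.H.commutator_eq_one_coprime[of "?f a" "?f b" "?f d" m k])
      show "inv\<^bsub>G Mod L (Suc i)\<^esub> ?f a \<otimes>\<^bsub>G Mod L (Suc i)\<^esub> inv\<^bsub>G Mod L (Suc i)\<^esub> ?f b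
          \<otimes>\<^bsub>G Mod L (Suc i)\<^esub> ?f a \<otimes>\<^bsub>G Mod L (Suc i)\<^esub> ?f b = ?f d"
        using c by (simp only: d_def q.hom_mult q.hom_inv inv_closed m_closed)
      show "?f a \<otimes>\<^bsub>G Mod L (Suc i)\<^esub> ?f d = ?f d \<otimes>\<^bsub>G Mod L (Suc i)\<^esub> ?f a"
        using H.rcos_commute_iff[OF dc c(1)] central_chainD(4)[OF L i d c(1)] by simp
      show "?f b \<otimes>\<^bsub>G Mod L (Suc i)\<^esub> ?f d = ?f d \<otimes>\<^bsub>G Mod L (Suc i)\<^esub> ?f b"
        using H.rcos_commute_iff[OF dc c(2)] central_chainD(4)[OF L i d c(2)] by simp
    qed (use c dc one a b cop q.hom_closed in auto)
    then show ?case using H.rcos_eq_one_iff[OF dc] by simp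
  qed
  then show ?thesis by (simp add: d_def)
qed

text \<open>The displacement \<open>d\<close> of \<open>g\<close> descends along the series. If \<open>d\<close> lies in \<open>L i\<close>, then modulo
\<open>L (i + 1)\<close> it is central and, being sent to a conjugate of itself, fixed by \<open>f\<close>; hence the \<open>r\<close>-th
iterate of \<open>f\<close> multiplies \<open>g\<close> by the \<open>r\<close>-th power of \<open>d\<close>, which is therefore trivial. The \<open>m\<close>-th power of
\<open>d\<close> is trivial too, because \<open>g\<close> and its image both have exponent \<open>m\<close>. Classes need only be preserved
on an invariant subgroup \<open>T\<close>, which allows Sylow subgroups of \<open>G\<close> to be treated one at a time.\<close>

lemma (in group) coprime_automorphism_mod_chain:
  assumes L: "central_chain G L n"
    and f: "f \<in> hom G G" and T: "subgroup T G" and fT: "\<And>x. x \<in> T \<Longrightarrow> f x \<in> T"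
    and cp: "\<And>x. x \<in> T \<Longrightarrow> \<exists>u\<in>carrier G. f x = inv u \<otimes> x \<otimes> u"
    and per: "\<And>x. x \<in> T \<Longrightarrow> (f ^^ r) x = x"
    and cop: "coprime r m" and g: "g \<in> T" "g [^] (m::nat) \<in> L n"
  shows "inv g \<otimes> f g \<in> L n"
proof -
  interpret T: subgroup T G by fact
  interpret f: group_hom G G f using f by unfold_locales
  define d where "d = inv g \<otimes> f g"
  have gc: "g \<in> carrier G" and fgT: "f g \<in> T" and dT: "d \<in> T" and dc: "d \<in> carrier G"
    using g fT by (auto simp: d_def)
  have fg: "f g = g \<otimes> d" using gc fgT by (simp add: d_def mult_inv_cancel_left)
  have itT: "(f ^^ j) x \<in> T" if "x \<in> T" for x j
    using that fT by (induction j) auto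
  have ithom: "(f ^^ j) (x \<otimes> y) = (f ^^ j) x \<otimes> (f ^^ j) y" if "x \<in> T" "y \<in> T" for x y j
    using that itT by (induction j) auto
  have "d \<in> L i" if "i \<le> n" for i
    using that
  proof (induction i)
    case 0
    then show ?case using dc central_chainD(1)[OF L] by simp
  next
    case (Suc i)
    then have d: "d \<in> L i" and i: "i < n" by auto
    interpret Li: normal "L i" G using central_chainD(2)[OF L] i by simp
    interpret H: normal "L (Suc i)" G using central_chainD(2)[OF L] Suc by simp
    let ?f = "\<lambda>x. L (Suc i) #> x"
    let ?Q = "G Mod L (Suc i)"
    interpret q: group_hom G ?Q ?f by (rule H.quotient_hom)
    \<comment> \<open>Class preservation makes \<open>f\<close> act trivially on the central factor \<open>L i\<close> modulo \<open>L (Suc i)\<close>.\<close>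
    have fx: "?f (f x) = ?f x \<and> f x \<in> L i" if x: "x \<in> T" "x \<in> L i" for x
    proof -
      obtain u where u: "u \<in> carrier G" "f x = inv u \<otimes> x \<otimes> u" using cp x by blast
      have xc: "x \<in> carrier G" using x by auto
      have "inv x \<otimes> f x = inv x \<otimes> inv u \<otimes> x \<otimes> u" using u xc by (simp add: m_assoc)
      then have "inv x \<otimes> f x \<in> L (Suc i)" using central_chainD(4)[OF L i x(2) u(1)] by simp
      then have "?f x = ?f (f x)" using H.rcos_eq_iff[of x "f x"] xc by simp
      moreover have "f x \<in> L i" using u x(2) Li.inv_op_closed1 by simp
      ultimately show ?thesis by simp
    qed
    have itd: "(f ^^ j) d \<in> L i \<and> ?f ((f ^^ j) d) = ?f d" for j
      using d dT fx itT by (induction j) auto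
    have itg: "?f ((f ^^ j) g) = ?f g \<otimes>\<^bsub>?Q\<^esub> (?f d) [^]\<^bsub>?Q\<^esub> j" for j
    proof (induction j)
      case 0
      have "?f g \<in> carrier ?Q" using gc q.hom_closed by blast
      then show ?case using q.H.r_one[of "?f g"] by (simp del: mult_FactGroup one_FactGroup)
    next
      case (Suc j)
      have "(f ^^ Suc j) g = (f ^^ j) (g \<otimes> d)" by (simp add: funpow_Suc_right fg del: funpow.simps)
      also have "\<dots> = (f ^^ j) g \<otimes> (f ^^ j) d" using ithom g dT by blast
      finally have "?f ((f ^^ Suc j) g) = ?f ((f ^^ j) g) \<otimes>\<^bsub>?Q\<^esub> ?f ((f ^^ j) d)"
        using q.hom_mult itT g dT by (metis T.mem_carrier)
      also have "\<dots> = ?f g \<otimes>\<^bsub>?Q\<^esub> (?f d [^]\<^bsub>?Q\<^esub> j) \<otimes>\<^bsub>?Q\<^esub> ?f d" using Suc itd by metis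
      also have "\<dots> = ?f g \<otimes>\<^bsub>?Q\<^esub> (?f d [^]\<^bsub>?Q\<^esub> Suc j)"
        using gc dc q.hom_closed by (simp add: q.H.m_assoc del: mult_FactGroup)
      finally show ?case .
    qed
    have cl: "?f g \<in> carrier ?Q" "?f d \<in> carrier ?Q" using gc dc q.hom_closed by blast+
    have "?f g = ?f g \<otimes>\<^bsub>?Q\<^esub> ?f d [^]\<^bsub>?Q\<^esub> r" using itg[of r] per[OF g(1)] by simp
    then have dr: "?f d [^]\<^bsub>?Q\<^esub> r = \<one>\<^bsub>?Q\<^esub>"
      using cl q.H.l_cancel_one'[of "?f g" "?f d [^]\<^bsub>?Q\<^esub> r"] by (metis q.H.nat_pow_closed)
    have one: "?f x [^]\<^bsub>?Q\<^esub> j = \<one>\<^bsub>?Q\<^esub>"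
      if "x \<in> carrier G" "x [^] j \<in> L n" for x and j :: nat
      using that q.hom_nat_pow[of x j] central_chainD(3)[OF L Suc.prems] H.rcos_eq_one_iff[of "x [^] j"]
      by auto
    obtain u where u: "u \<in> carrier G" "f (g [^] m) = inv u \<otimes> g [^] m \<otimes> u"
      using cp[of "g [^] m"] subgroup_nat_pow_closed[OF T] g by blast
    have "(f g) [^] m \<in> L n"
      using u g(2) normal.inv_op_closed1[OF central_chainD(2)[OF L order_refl] u(1) g(2)]
        f.hom_nat_pow[OF gc] by simp
    then have "?f (g \<otimes> d) [^]\<^bsub>?Q\<^esub> m = \<one>\<^bsub>?Q\<^esub>" using one[of "g \<otimes> d" m] fg gc dc m_closed by auto
    moreover have "?f g \<otimes>\<^bsub>?Q\<^esub> ?f d = ?f d \<otimes>\<^bsub>?Q\<^esub> ?f g"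
      using H.rcos_commute_iff[OF dc gc] central_chainD(4)[OF L i d gc] by simp
    ultimately have "?f g [^]\<^bsub>?Q\<^esub> m \<otimes>\<^bsub>?Q\<^esub> ?f d [^]\<^bsub>?Q\<^esub> m = \<one>\<^bsub>?Q\<^esub>"
      using q.H.pow_mult_distrib[of "?f g" "?f d" m] cl q.hom_mult[OF gc dc] by simp
    then have "?f d [^]\<^bsub>?Q\<^esub> m = \<one>\<^bsub>?Q\<^esub>" using one[OF gc g(2)] cl q.H.l_one q.H.nat_pow_closed by metis
    then have "?f d = \<one>\<^bsub>?Q\<^esub>" using q.H.coprime_pow_eq_one[OF cl(2) dr _ cop] by blast
    then show ?case using H.rcos_eq_one_iff[OF dc] by simp
  qed
  then show ?thesis by (simp add: d_def)
qed

lemma (in group) lower_central_normal: "lower_central G n \<lhd> G"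
proof (induction n)
  case 0
  then show ?case by (simp add: normal_invI subgroup_self)
next
  case (Suc n)
  interpret L: normal "lower_central G n" G by fact
  let ?S = "{inv x \<otimes> inv y \<otimes> x \<otimes> y | x y. x \<in> lower_central G n \<and> y \<in> carrier G}"
  have "generate G ?S \<lhd> G"
  proof (rule normal_generateI)
    show "?S \<subseteq> carrier G" by auto
    fix h g assume "h \<in> ?S" and g: "g \<in> carrier G"
    then obtain x y where h: "h = inv x \<otimes> inv y \<otimes> x \<otimes> y" "x \<in> lower_central G n" "y \<in> carrier G"
      by blast
    have xc: "x \<in> carrier G" using h by auto
    have e: "g \<otimes> h \<otimes> inv g = inv (g \<otimes> x \<otimes> inv g) \<otimes> inv (g \<otimes> y \<otimes> inv g) \<otimes> (g \<otimes> x \<otimes> inv g) \<otimes> (g \<otimes> y \<otimes> inv g)"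
      using g h xc by (simp add: m_assoc inv_mult_group mult_inv_cancel_left)
    have "g \<otimes> x \<otimes> inv g \<in> lower_central G n" using g h L.inv_op_closed2 by simp
    then show "g \<otimes> h \<otimes> inv g \<in> ?S" unfolding e using g h(3) by fast
  qed
  then show ?case by simp
qed

lemma (in group) lower_central_commutator:
  assumes "x \<in> lower_central G n" "y \<in> carrier G"
  shows "inv x \<otimes> inv y \<otimes> x \<otimes> y \<in> lower_central G (Suc n)"
  using assms by (auto intro!: generate.incl)

lemma nilpotent_central_chain:
  assumes "nilpotent_group G"
  obtains L n where "central_chain G L n" "L n = {\<one>\<^bsub>G\<^esub>}"
proof -
  interpret group G using assms by (simp add: nilpotent_group_def)
  obtain n where n: "lower_central G n = {\<one>\<^bsub>G\<^esub>}" using assms by (auto simp: nilpotent_group_def)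
  have "\<one>\<^bsub>G\<^esub> \<in> lower_central G i" for i
    using lower_central_normal[of i] by (simp add: normal_imp_subgroup subgroup.one_closed)
  then have "central_chain G (lower_central G) n"
    unfolding central_chain_def using lower_central_normal lower_central_commutator n by auto
  then show ?thesis using that n by blast
qed

text \<open>Pulling the series of the quotient back turns nilpotency of \<open>G Mod H\<close> into a statement about \<open>G\<close>.\<close>

lemma (in normal) central_chain_vimage:
  assumes L: "central_chain (G Mod H) L n" and n: "L n = {\<one>\<^bsub>G Mod H\<^esub>}"
  defines "M \<equiv> \<lambda>i. {x \<in> carrier G. H #> x \<in> L i}"
  shows "central_chain G M n" "M n = H"
proof -
  interpret q: group_hom G "G Mod H" "\<lambda>x. H #> x" by (rule quotient_hom)
  have Miff: "x \<in> M i \<longleftrightarrow> x \<in> carrier G \<and> H #> x \<in> L i" for x i by (simp add: M_def)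
  show Mn: "M n = H" 
  proof (rule Set.set_eqI)
    show "x \<in> M n \<longleftrightarrow> x \<in> H" for x
      using rcos_eq_one_iff[of x] mem_carrier[of x] unfolding Miff n by blast
  qed
  have nor: "M i \<lhd> G" if "i \<le> n" for i
  proof -
    interpret L: normal "L i" "G Mod H" using central_chainD(2)[OF L that] .
    show ?thesis
    proof (rule normal_invI)
      show "subgroup (M i) G"
      proof (rule subgroupI)
        show "M i \<subseteq> carrier G" by (auto simp: M_def)
        show "M i \<noteq> {}" using Miff[of \<one> i] L.one_closed q.hom_one one_closed by (metis empty_iff)
        show "inv x \<in> M i" if "x \<in> M i" for x
          using that L.m_inv_closed[of "H #> x"] q.hom_inv[of x] by (simp only: Miff inv_closed)
        show "x \<otimes> y \<in> M i" if "x \<in> M i" "y \<in> M i" for x y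
          using that L.m_closed[of "H #> x" "H #> y"] q.hom_mult[of x y] by (simp only: Miff m_closed)
      qed
      fix h x assume x: "x \<in> carrier G" and h: "h \<in> M i"
      then have hc: "h \<in> carrier G" "H #> h \<in> L i" by (simp_all only: Miff)
      have "H #> (x \<otimes> h \<otimes> inv x) = (H #> x) \<otimes>\<^bsub>G Mod H\<^esub> (H #> h) \<otimes>\<^bsub>G Mod H\<^esub> inv\<^bsub>G Mod H\<^esub> (H #> x)"
        using x hc by (simp only: q.hom_mult q.hom_inv m_closed inv_closed)
      then show "x \<otimes> h \<otimes> inv x \<in> M i"
        using x hc L.inv_op_closed2[of "H #> x" "H #> h"] q.hom_closed[of x]
        by (simp only: Miff m_closed inv_closed)
    qed
  qed
  have sub: "M n \<subseteq> M i" if "i \<le> n" for i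
    using central_chainD(3)[OF L that] unfolding M_def by blast
  have com: "inv x \<otimes> inv y \<otimes> x \<otimes> y \<in> M (Suc i)" if "i < n" "x \<in> M i" "y \<in> carrier G" for i x y
  proof -
    have x: "x \<in> carrier G" "H #> x \<in> L i" using that by (simp_all only: Miff)
    have "H #> (inv x \<otimes> inv y \<otimes> x \<otimes> y) = inv\<^bsub>G Mod H\<^esub> (H #> x) \<otimes>\<^bsub>G Mod H\<^esub> inv\<^bsub>G Mod H\<^esub> (H #> y) \<otimes>\<^bsub>G Mod H\<^esub> (H #> x) \<otimes>\<^bsub>G Mod H\<^esub> (H #> y)"
      using x that(3) by (simp only: q.hom_mult q.hom_inv m_closed inv_closed)
    then show ?thesis
      using central_chainD(4)[OF L that(1) x(2), of "H #> y"] x(1) that(3) q.hom_closed[of y]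
      by (simp only: Miff m_closed inv_closed)
  qed
  have "M 0 = carrier G" unfolding M_def central_chainD(1)[OF L] using q.hom_closed by blast
  then show "central_chain G M n" unfolding central_chain_def using nor sub com by blast
qed

lemma nilpotent_quotient_central_chain:
  assumes "H \<lhd> G" "nilpotent_group (G Mod H)"
  obtains L n where "central_chain G L n" "L n = H"
proof -
  obtain L n where "central_chain (G Mod H) L n" "L n = {\<one>\<^bsub>G Mod H\<^esub>}"
    using nilpotent_central_chain[OF assms(2)] .
  from that[OF normal.central_chain_vimage[OF assms(1) this]] show ?thesis .
qed

section \<open>Sylow subgroups of nilpotent groups, normal subgroups and quotients\<close>

lemma (in group_hom) order_eq_card_image_kernel:
  "order G = card (h ` carrier G) * card (kernel G H h)"
proof -
  let ?I = "H\<lparr>carrier := h ` carrier G\<rparr>"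
  have "group ?I" using H.subgroup_imp_group[OF img_is_subgroup] .
  moreover have "h \<in> hom G ?I" by (auto simp: hom_def)
  ultimately interpret I: group_hom G ?I h
    using G.is_group by (intro group_hom.intro group_hom_axioms.intro)
  have "kernel G ?I h = kernel G H h" by (simp add: kernel_def)
  then have "order (G Mod kernel G H h) = card (h ` carrier G)"
    using iso_same_order[OF I.FactGroup_iso_set] by (simp add: order_def)
  then show ?thesis
    using G.lagrange[OF subgroup_kernel] by (simp add: order_def FactGroup_def)
qed

lemma (in group) subgroup_card_dvd:
  assumes "subgroup A G" "subgroup B G" "A \<subseteq> B"
  shows "card A dvd card B"
proof -
  interpret B: group "G\<lparr>carrier := B\<rparr>" using subgroup_imp_group assms by blast
  show ?thesis using B.lagrange[OF subgroup_incl[OF assms]] by (simp add: order_def) (metis dvd_triv_right)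
qed

lemma (in group) subgroup_pow_card:
  assumes "subgroup R G" "x \<in> R"
  shows "x [^] card R = \<one>"
proof -
  interpret R: group "G\<lparr>carrier := R\<rparr>" using subgroup_imp_group assms by blast
  show ?thesis using R.pow_order_eq_1[of x] assms by (simp add: order_def nat_pow_consistent[symmetric])
qed

lemma (in group) sylow_subgroup_exists:
  assumes "finite (carrier G)" "Factorial_Ring.prime (q::nat)"
  obtains R where "sylow_subgroup G q R"
proof -
  obtain m where "order G = q ^ multiplicity q (order G) * m"
    using multiplicity_dvd by blast
  then show ?thesis using sylow_thm[OF assms(2) is_group _ assms(1)] that
    by (metis sylow_subgroup_def)
qed

lemma prime_power_dvd_imp_le_multiplicity:
  assumes "Factorial_Ring.prime (p::nat)" "n \<noteq> 0" "p ^ k dvd n"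
  shows "k \<le> multiplicity p n"
  using assms by (intro multiplicity_geI) auto

text \<open>The order of \<open>H\<close> is divisible by every maximal prime power dividing the order of \<open>G\<close>.\<close>

lemma (in group) subgroup_containing_sylows:
  assumes fin: "finite (carrier G)" and H: "subgroup H G"
    and R: "\<And>q. Factorial_Ring.prime (q::nat) \<Longrightarrow> q dvd order G \<Longrightarrow> \<exists>R. sylow_subgroup G q R \<and> R \<subseteq> H"
  shows "H = carrier G"
proof -
  have o: "order G \<noteq> 0" using fin by (auto simp: order_def)
  have finH: "finite H" using fin H finite_subset subgroup.subset by blast
  then have cH: "card H \<noteq> 0" using subgroup.one_closed[OF H] by auto
  have "order G dvd card H"
  proof (rule multiplicity_le_imp_dvd[OF o])
    fix q :: nat assume q: "Factorial_Ring.prime q"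
    show "multiplicity q (order G) \<le> multiplicity q (card H)"
    proof (cases "q dvd order G")
      case True
      then obtain R where "subgroup R G" "card R = q ^ multiplicity q (order G)" "R \<subseteq> H"
        using R[OF q] by (auto simp: sylow_subgroup_def)
      then have "q ^ multiplicity q (order G) dvd card H" using subgroup_card_dvd H by metis
      then show ?thesis using prime_power_dvd_imp_le_multiplicity[OF q cH] by blast
    qed (simp add: not_dvd_imp_multiplicity_0)
  qed
  then have "order G \<le> card H" using cH by (simp add: dvd_imp_le)
  then show ?thesis using fin H subgroup.subset card_seteq by (metis order_def)
qed

lemma (in group) coprime_sylow_index:
  assumes fin: "finite (carrier G)" and p: "Factorial_Ring.prime (p::nat)" and P: "sylow_subgroup G p P"
  shows "coprime p (card (rcosets P))"
proof -
  have o: "order G \<noteq> 0" using fin by (auto simp: order_def)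
  have "card (rcosets P) * p ^ multiplicity p (order G) = order G"
    using lagrange[of P] P by (simp add: sylow_subgroup_def)
  then have "\<not> p dvd card (rcosets P)"
    using prime_power_dvd_imp_le_multiplicity[OF p o, of "Suc (multiplicity p (order G))"]
    by (metis Suc_n_not_le_n dvd_refl mult_dvd_mono power_Suc)
  then show ?thesis using p by (simp add: prime_imp_coprime)
qed

lemma nilpotent_coprime_commute:
  assumes nil: "nilpotent_group G" and a: "a \<in> carrier G" "a [^]\<^bsub>G\<^esub> (m::nat) = \<one>\<^bsub>G\<^esub>"
    and b: "b \<in> carrier G" "b [^]\<^bsub>G\<^esub> (k::nat) = \<one>\<^bsub>G\<^esub>" and cop: "coprime m k"
  shows "a \<otimes>\<^bsub>G\<^esub> b = b \<otimes>\<^bsub>G\<^esub> a"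
proof -
  interpret group G using nil by (simp add: nilpotent_group_def)
  obtain L n where L: "central_chain G L n" "L n = {\<one>\<^bsub>G\<^esub>}" using nilpotent_central_chain[OF nil] .
  have "inv\<^bsub>G\<^esub> a \<otimes>\<^bsub>G\<^esub> inv\<^bsub>G\<^esub> b \<otimes>\<^bsub>G\<^esub> a \<otimes>\<^bsub>G\<^esub> b \<in> {\<one>\<^bsub>G\<^esub>}"
    using coprime_commute_mod_chain[OF L(1) a(1) b(1) _ _ cop] a(2) b(2) L(2) by simp
  then have "inv\<^bsub>G\<^esub> (b \<otimes>\<^bsub>G\<^esub> a) \<otimes>\<^bsub>G\<^esub> (a \<otimes>\<^bsub>G\<^esub> b) = \<one>\<^bsub>G\<^esub>"
    using a b by (simp add: inv_mult_group m_assoc)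
  then show ?thesis using a b by (metis inv_equality inv_inv m_closed inv_closed)
qed

text \<open>The normaliser of \<open>P\<close> contains \<open>P\<close>, and it contains every Sylow subgroup for another prime because
elements of coprime orders commute; so it is everything. Modulo the normal subgroup \<open>P\<close>, whose
index is prime to \<open>p\<close>, an element of \<open>p\<close>-power order is trivial.\<close>

lemma nilpotent_sylow_contains:
  assumes nil: "nilpotent_group G" and fin: "finite (carrier G)" and p: "Factorial_Ring.prime (p::nat)"
    and P: "sylow_subgroup G p P" and x: "x \<in> carrier G" "x [^]\<^bsub>G\<^esub> (p ^ k) = \<one>\<^bsub>G\<^esub>"
  shows "x \<in> P"
proof -
  interpret group G using nil by (simp add: nilpotent_group_def)
  have PG: "subgroup P G" "card P = p ^ multiplicity p (order G)" using P by (auto simp: sylow_subgroup_def)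
  interpret P: subgroup P G by fact
  define H where "H = {g \<in> carrier G. \<forall>y\<in>P. inv\<^bsub>G\<^esub> g \<otimes>\<^bsub>G\<^esub> y \<otimes>\<^bsub>G\<^esub> g \<in> P \<and> g \<otimes>\<^bsub>G\<^esub> y \<otimes>\<^bsub>G\<^esub> inv\<^bsub>G\<^esub> g \<in> P}"
  have H: "subgroup H G"
  proof (rule subgroupI)
    show "H \<subseteq> carrier G" "H \<noteq> {}" by (auto simp: H_def intro!: exI[of _ "\<one>\<^bsub>G\<^esub>"])
    show "inv\<^bsub>G\<^esub> g \<in> H" if "g \<in> H" for g using that by (auto simp: H_def)
    show "g \<otimes>\<^bsub>G\<^esub> h \<in> H" if g: "g \<in> H" and h: "h \<in> H" for g h
    proof -
      have c: "g \<in> carrier G" "h \<in> carrier G" using g h by (auto simp: H_def)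
      have "inv\<^bsub>G\<^esub> h \<otimes>\<^bsub>G\<^esub> (inv\<^bsub>G\<^esub> g \<otimes>\<^bsub>G\<^esub> y \<otimes>\<^bsub>G\<^esub> g) \<otimes>\<^bsub>G\<^esub> h \<in> P"
        "g \<otimes>\<^bsub>G\<^esub> (h \<otimes>\<^bsub>G\<^esub> y \<otimes>\<^bsub>G\<^esub> inv\<^bsub>G\<^esub> h) \<otimes>\<^bsub>G\<^esub> inv\<^bsub>G\<^esub> g \<in> P" if "y \<in> P" for y
        using g h that by (auto simp: H_def)
      then show ?thesis using c by (simp add: H_def inv_mult_group m_assoc)
    qed
  qed
  have "H = carrier G"
  proof (rule subgroup_containing_sylows[OF fin H])
    fix q :: nat assume q: "Factorial_Ring.prime q"
    show "\<exists>R. sylow_subgroup G q R \<and> R \<subseteq> H"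
    proof (cases "q = p")
      case True
      have "P \<subseteq> H" by (auto simp: H_def)
      then show ?thesis using P True by blast
    next
      case False
      obtain R where R: "sylow_subgroup G q R" using sylow_subgroup_exists[OF fin q] .
      then have RG: "subgroup R G" "card R = q ^ multiplicity q (order G)" by (auto simp: sylow_subgroup_def)
      have "g \<in> H" if g: "g \<in> R" for g
      proof -
        have gc: "g \<in> carrier G" using g RG subgroup.mem_carrier by metis
        have "g \<otimes>\<^bsub>G\<^esub> y = y \<otimes>\<^bsub>G\<^esub> g" if "y \<in> P" for y
        proof (rule nilpotent_coprime_commute[OF nil gc])
          show "g [^]\<^bsub>G\<^esub> card R = \<one>\<^bsub>G\<^esub>" "y [^]\<^bsub>G\<^esub> card P = \<one>\<^bsub>G\<^esub>"
            using subgroup_pow_card RG PG g that by blast+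
          show "coprime (card R) (card P)"
            using RG PG False p q primes_coprime by (metis coprime_power_left_iff coprime_power_right_iff)
        qed (use that in auto)
        then have "inv\<^bsub>G\<^esub> g \<otimes>\<^bsub>G\<^esub> y \<otimes>\<^bsub>G\<^esub> g = y \<and> g \<otimes>\<^bsub>G\<^esub> y \<otimes>\<^bsub>G\<^esub> inv\<^bsub>G\<^esub> g = y" if "y \<in> P" for y
          using that gc by (metis P.mem_carrier inv_closed inv_solve_right' m_assoc mult_inv_cancel_left(2) m_closed)
        then show ?thesis using gc by (simp add: H_def)
      qed
      then show ?thesis using R by blast
    qed
  qed
  then have nor: "P \<lhd> G" using PG by (intro normal_invI) (auto simp: H_def)
  interpret P: normal P G by (rule nor)
  interpret q: group_hom G "G Mod P" "\<lambda>x. P #>\<^bsub>G\<^esub> x" by (rule P.quotient_hom)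
  have cop: "coprime (p ^ k) (order (G Mod P))"
    using coprime_sylow_index[OF fin p P] by (simp add: order_def FactGroup_def)
  have c: "P #>\<^bsub>G\<^esub> x \<in> carrier (G Mod P)" using x q.hom_closed by blast
  have "(P #>\<^bsub>G\<^esub> x) [^]\<^bsub>G Mod P\<^esub> (p ^ k) = \<one>\<^bsub>G Mod P\<^esub>"
    using q.hom_nat_pow[OF x(1), of "p ^ k"] x(2) q.hom_one by simp
  then have "P #>\<^bsub>G\<^esub> x = \<one>\<^bsub>G Mod P\<^esub>"
    using q.H.coprime_pow_eq_one[OF c _ q.H.pow_order_eq_1[OF c] cop] by blast
  then show ?thesis using P.rcos_eq_one_iff[OF x(1)] by blast
qed

text \<open>The orders of \<open>R \<inter> H\<close> and of the image of \<open>R\<close> are powers of \<open>p\<close> dividing the orders of \<open>H\<close> and of the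
quotient. Their product is the full \<open>p\<close>-part of the order of \<open>G\<close>, so both are as large as possible.\<close>

lemma (in normal) sylow_inter_image:
  assumes fin: "finite (carrier G)" and p: "Factorial_Ring.prime (p::nat)" and R: "sylow_subgroup G p R"
  shows "sylow_subgroup (G\<lparr>carrier := H\<rparr>) p (R \<inter> H)"
    and "sylow_subgroup (G Mod H) p ((\<lambda>x. H #> x) ` R)"
proof -
  interpret q: group_hom G "G Mod H" "\<lambda>x. H #> x" by (rule quotient_hom)
  have RG: "subgroup R G" and cR: "card R = p ^ multiplicity p (order G)" using R by (auto simp: sylow_subgroup_def)
  interpret R: group_hom "G\<lparr>carrier := R\<rparr>" "G Mod H" "\<lambda>x. H #> x"
    using q.induced_group_hom'[OF RG] .
  let ?I = "(\<lambda>x. H #> x) ` R"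
  have k: "kernel (G\<lparr>carrier := R\<rparr>) (G Mod H) (\<lambda>x. H #> x) = R \<inter> H"
    using rcos_eq_one_iff subgroup.mem_carrier[OF RG] by (auto simp: kernel_def simp del: one_FactGroup)
  have c1: "card ?I * card (R \<inter> H) = p ^ multiplicity p (order G)"
    using R.order_eq_card_image_kernel k cR by (simp add: order_def)
  have sI: "subgroup ?I (G Mod H)" using R.img_is_subgroup by simp
  have sRH: "subgroup (R \<inter> H) G" using subgroups_Inter_pair[OF RG is_subgroup] .
  have c2: "order (G Mod H) * card H = order G"
    using lagrange[OF is_subgroup] by (simp add: order_def FactGroup_def)
  have o: "order G \<noteq> 0" using fin by (auto simp: order_def)
  then have o2: "order (G Mod H) \<noteq> 0" "card H \<noteq> 0" using c2 by (metis mult_is_0)+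
  obtain i where i: "card ?I = p ^ i" using c1 divides_primepow_nat[OF p] by (metis dvd_triv_left)
  obtain j where j: "card (R \<inter> H) = p ^ j" using c1 divides_primepow_nat[OF p] by (metis dvd_triv_right)
  have pe: "prime_elem p" using p by simp
  have "p ^ (i + j) = p ^ multiplicity p (order G)" using c1 i j by (simp add: power_add)
  then have ij: "i + j = multiplicity p (order (G Mod H)) + multiplicity p (card H)"
    using p o2 c2 prime_elem_multiplicity_mult_distrib[OF pe o2] prime_gt_1_nat[OF p]
    by (metis power_inject_exp)
  have "p ^ i dvd order (G Mod H)" using q.H.subgroup_card_dvd[OF sI q.H.subgroup_self] sI i
    by (metis order_def subgroup.subset)
  then have i1: "i \<le> multiplicity p (order (G Mod H))" using prime_power_dvd_imp_le_multiplicity[OF p] o2 by blast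
  have "p ^ j dvd card H" using subgroup_card_dvd[OF sRH is_subgroup] j by auto
  then have j1: "j \<le> multiplicity p (card H)" using prime_power_dvd_imp_le_multiplicity[OF p] o2 by blast
  have ii: "i = multiplicity p (order (G Mod H))" and jj: "j = multiplicity p (card H)"
    using i1 j1 ij by linarith+
  have "subgroup (R \<inter> H) (G\<lparr>carrier := H\<rparr>)" using subgroup_incl[OF sRH is_subgroup] by blast
  then show "sylow_subgroup (G\<lparr>carrier := H\<rparr>) p (R \<inter> H)"
    using jj j by (simp add: sylow_subgroup_def order_def)
  show "sylow_subgroup (G Mod H) p ?I"
    using sI ii i by (simp add: sylow_subgroup_def)
qed

section \<open>Averaging a cocycle over the cosets of a Sylow subgroup\<close>

lemma (in comm_group) finprod_endomorphism:
  assumes "\<phi> \<in> hom G G" "finite A" "g \<in> A \<rightarrow> carrier G"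
  shows "\<phi> (finprod G g A) = finprod G (\<lambda>x. \<phi> (g x)) A"
proof -
  interpret group_hom G G \<phi> using assms(1) by unfold_locales
  show ?thesis using assms(2,3)
  proof (induction A rule: finite_induct)
    case empty
    then show ?case by simp
  next
    case (insert x F)
    then have c: "g \<in> F \<rightarrow> carrier G" "g x \<in> carrier G" by auto
    then have "(\<lambda>x. \<phi> (g x)) \<in> F \<rightarrow> carrier G" using hom_closed by fast
    then show ?case using insert c finprod_insert[OF insert(1,2)] by (simp add: hom_mult)
  qed
qed

text \<open>Put \<open>d g = inv g \<otimes> f g\<close>. As \<open>f\<close> fixes \<open>N\<close> pointwise, \<open>d\<close> takes values in the centre \<open>A\<close> of \<open>N\<close>,
satisfies \<open>d (g \<otimes> h) = (inv h \<otimes> d g \<otimes> h) \<otimes> d h\<close>, is constant on the cosets of \<open>S\<close> and has values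
of order dividing \<open>p ^ k\<close>. Let \<open>a\<close> be the product of \<open>d\<close> over all these cosets. Right
multiplication by \<open>h\<close> permutes the cosets, so the cocycle identity multiplies up to
\<open>a = (inv h \<otimes> a \<otimes> h) \<otimes> d h [^] r\<close> with \<open>r\<close> the number of cosets. Since \<open>r\<close> is invertible modulo \<open>p ^ k\<close>,
a suitable power \<open>b\<close> of \<open>a\<close> satisfies \<open>d h = inv h \<otimes> inv b \<otimes> h \<otimes> b\<close>.\<close>

lemma (in group) inner_if_trivial_on_sylow:
  assumes fin: "finite (carrier G)" and p: "Factorial_Ring.prime (p::nat)"
    and N: "N \<lhd> G" and S: "subgroup S G" and idx: "coprime p (card (rcosets S))"
    and f: "f \<in> hom G G" and fN: "\<And>x. x \<in> N \<Longrightarrow> f x = x" and fS: "\<And>x. x \<in> S \<Longrightarrow> f x = x"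
    and quo: "\<And>g. g \<in> carrier G \<Longrightarrow> inv g \<otimes> f g \<in> N"
    and per: "\<And>g. g \<in> carrier G \<Longrightarrow> (f ^^ (p ^ k)) g = g"
  obtains b where "b \<in> carrier G" "\<And>g. g \<in> carrier G \<Longrightarrow> f g = inv b \<otimes> g \<otimes> b"
proof -
  interpret N: normal N G by (rule N)
  interpret S: subgroup S G by (rule S)
  interpret f: group_hom G G f using f by unfold_locales
  define A where "A = {z \<in> N. \<forall>n\<in>N. z \<otimes> n = n \<otimes> z}"
  have AN: "z \<in> N" if "z \<in> A" for z using that unfolding A_def by blast
  have AG: "A \<subseteq> carrier G" using AN N.mem_carrier by blast
  have Acomm: "z \<otimes> n = n \<otimes> z" if "z \<in> A" "n \<in> N" for z n using that unfolding A_def by blast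
  have AI: "z \<in> A" if "z \<in> N" "\<And>n. n \<in> N \<Longrightarrow> z \<otimes> n = n \<otimes> z" for z using that unfolding A_def by blast
  have A_conj: "inv h \<otimes> z \<otimes> h \<in> A" if z: "z \<in> A" and h: "h \<in> carrier G" for z h
  proof -
    have zc: "z \<in> carrier G" using z AG by blast
    have "(inv h \<otimes> z \<otimes> h) \<otimes> n = n \<otimes> (inv h \<otimes> z \<otimes> h)" if n: "n \<in> N" for n
    proof -
      have nc: "n \<in> carrier G" using n by simp
      have "z \<otimes> (h \<otimes> n \<otimes> inv h) = (h \<otimes> n \<otimes> inv h) \<otimes> z"
        by (rule Acomm[OF z N.inv_op_closed2[OF h n]])
      then have "inv h \<otimes> (z \<otimes> (h \<otimes> n \<otimes> inv h)) \<otimes> h = inv h \<otimes> ((h \<otimes> n \<otimes> inv h) \<otimes> z) \<otimes> h" by simp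
      then show ?thesis using zc nc h by (simp add: m_assoc mult_inv_cancel_left)
    qed
    moreover have "inv h \<otimes> z \<otimes> h \<in> N" using AN[OF z] h N.inv_op_closed1 by blast
    ultimately show ?thesis using AI by blast
  qed
  have subA: "subgroup A G"
  proof (rule subgroupI[OF AG])
    have "\<one> \<in> A" by (rule AI) simp_all
    then show "A \<noteq> {}" by blast
    show "inv z \<in> A" if z: "z \<in> A" for z
    proof (rule AI)
      show "inv z \<in> N" using AN[OF z] by simp
      show "inv z \<otimes> n = n \<otimes> inv z" if n: "n \<in> N" for n
        using commute_inv[of n z] Acomm[OF z n] AN[OF z] n by simp
    qed
    show "y \<otimes> z \<in> A" if y: "y \<in> A" and z: "z \<in> A" for y z
    proof (rule AI)
      show "y \<otimes> z \<in> N" using AN y z by simp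
      show "y \<otimes> z \<otimes> n = n \<otimes> (y \<otimes> z)" if n: "n \<in> N" for n
        using commute_mult[of n y z] Acomm[OF y n] Acomm[OF z n] AN y z n by simp
    qed
  qed
  let ?Z = "G\<lparr>carrier := A\<rparr>"
  have "comm_group ?Z"
    by (rule group.group_comm_groupI[OF subgroup_imp_group[OF subA]]) (simp add: Acomm AN)
  then interpret Z: comm_group ?Z .
  have Zpow: "x [^]\<^bsub>?Z\<^esub> (j::nat) = x [^] j" for x j
    by (simp add: nat_pow_consistent[symmetric])
  define d where "d = (\<lambda>g. inv g \<otimes> f g)"
  have dN: "d g \<in> N" if "g \<in> carrier G" for g using quo that by (simp add: d_def)
  have dc: "d g \<in> carrier G" if "g \<in> carrier G" for g using that by (simp add: d_def)
  have fd: "f g = g \<otimes> d g" if "g \<in> carrier G" for g using that by (simp add: d_def mult_inv_cancel_left)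
  have dA: "d g \<in> A" if g: "g \<in> carrier G" for g
  proof -
    have "d g \<otimes> n = n \<otimes> d g" if n: "n \<in> N" for n
    proof -
      have nc: "n \<in> carrier G" using n by simp
      have "f (g \<otimes> n \<otimes> inv g) = g \<otimes> n \<otimes> inv g" using fN N.inv_op_closed2[OF g n] by blast
      then have "g \<otimes> d g \<otimes> n \<otimes> inv (g \<otimes> d g) = g \<otimes> n \<otimes> inv g"
        using g nc fd[OF g] fN[OF n] by simp
      then have "inv g \<otimes> (g \<otimes> d g \<otimes> n \<otimes> inv (g \<otimes> d g)) \<otimes> (g \<otimes> d g) = inv g \<otimes> (g \<otimes> n \<otimes> inv g) \<otimes> (g \<otimes> d g)"
        by simp
      then show ?thesis using g nc dc[OF g] by (simp add: m_assoc inv_mult_group mult_inv_cancel_left)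
    qed
    then show ?thesis using dN[OF g] AI by blast
  qed
  have d_mult: "d (g \<otimes> h) = (inv h \<otimes> d g \<otimes> h) \<otimes> d h" if "g \<in> carrier G" "h \<in> carrier G" for g h
    using that by (simp add: d_def m_assoc inv_mult_group mult_inv_cancel_left)
  have dp: "d g [^] (p ^ k) = \<one>" if g: "g \<in> carrier G" for g
  proof -
    have itd: "(f ^^ j) (d g) = d g" for j by (induction j) (use dN[OF g] fN in auto)
    have ithom: "(f ^^ j) (x \<otimes> y) = (f ^^ j) x \<otimes> (f ^^ j) y \<and> (f ^^ j) x \<in> carrier G"
      if "x \<in> carrier G" "y \<in> carrier G" for x y j
      using that by (induction j arbitrary: x y) (auto simp: funpow_Suc_right simp del: funpow.simps)
    have "(f ^^ j) g = g \<otimes> d g [^] j" for j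
    proof (induction j)
      case (Suc j)
      have "(f ^^ Suc j) g = (f ^^ j) (g \<otimes> d g)" using fd[OF g] by (simp add: funpow_Suc_right del: funpow.simps)
      also have "\<dots> = g \<otimes> d g [^] j \<otimes> d g" using ithom[OF g dc[OF g]] Suc itd by simp
      finally show ?case using g dc[OF g] by (simp add: m_assoc)
    qed (use g in simp)
    then have "g \<otimes> d g [^] (p ^ k) = g \<otimes> \<one>" using per[OF g] g by simp
    then show ?thesis using g dc[OF g] l_cancel[of g] by blast
  qed
  define D where "D = (\<lambda>C. d (SOME g. g \<in> C))"
  have D: "D (S #> g) = d g" if g: "g \<in> carrier G" for g
  proof -
    have "(SOME x. x \<in> S #> g) \<in> S #> g" using rcos_self[OF g S] by (rule someI)
    then obtain s where s: "s \<in> S" "(SOME x. x \<in> S #> g) = s \<otimes> g" by (auto simp: r_coset_def)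
    have "d s = \<one>" using fS[OF s(1)] s(1) by (simp add: d_def)
    then show ?thesis using d_mult[of s g] s g dc[OF g] by (simp add: D_def)
  qed
  have DA: "D C \<in> A" if "C \<in> rcosets S" for C
    using that D dA by (auto simp: RCOSETS_def)
  have finR: "finite (rcosets S)" using fin by (simp add: RCOSETS_def)
  define a where "a = finprod ?Z D (rcosets S)"
  have aA: "a \<in> A" unfolding a_def using Z.finprod_closed[of D "rcosets S"] DA by auto
  then have ac: "a \<in> carrier G" using AG by blast
  \<comment> \<open>The product of the cocycle identity over all cosets.\<close>
  have key: "d h [^] card (rcosets S) = (inv h \<otimes> inv a \<otimes> h) \<otimes> a" if h: "h \<in> carrier G" for h
  proof -
    define \<phi> where "\<phi> = (\<lambda>z. inv h \<otimes> z \<otimes> h)"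
    have \<phi>: "\<phi> \<in> hom ?Z ?Z"
      using h AG A_conj by (auto simp: hom_def \<phi>_def m_assoc subset_iff mult_inv_cancel_left)
    have im: "(\<lambda>C. C #> h) ` (rcosets S) = rcosets S"
    proof
      show "(\<lambda>C. C #> h) ` (rcosets S) \<subseteq> rcosets S"
        using h S.subset by (auto simp: RCOSETS_def coset_mult_assoc)
      show "rcosets S \<subseteq> (\<lambda>C. C #> h) ` (rcosets S)"
      proof
        fix C assume "C \<in> rcosets S"
        then obtain g where g: "g \<in> carrier G" "C = S #> g" by (auto simp: RCOSETS_def)
        have "C = (S #> (g \<otimes> inv h)) #> h" using g h S.subset by (simp add: coset_mult_assoc m_assoc)
        moreover have "S #> (g \<otimes> inv h) \<in> rcosets S" using g h by (simp add: rcosetsI S.subset)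
        ultimately show "C \<in> (\<lambda>C. C #> h) ` (rcosets S)" by blast
      qed
    qed
    have inj: "inj_on (\<lambda>C. C #> h) (rcosets S)" using finR im by (simp add: eq_card_imp_inj_on)
    have "a = finprod ?Z D ((\<lambda>C. C #> h) ` (rcosets S))" by (simp only: a_def im)
    also have "\<dots> = finprod ?Z (\<lambda>C. D (C #> h)) (rcosets S)"
      using inj DA im by (intro Z.finprod_reindex) auto
    also have "\<dots> = finprod ?Z (\<lambda>C. \<phi> (D C) \<otimes>\<^bsub>?Z\<^esub> d h) (rcosets S)"
    proof (rule Z.finprod_cong')
      show "(\<lambda>C. \<phi> (D C) \<otimes>\<^bsub>?Z\<^esub> d h) \<in> rcosets S \<rightarrow> carrier ?Z"
        using DA A_conj[OF _ h] dA[OF h] subgroup.m_closed[OF subA] by (auto simp: \<phi>_def)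
      fix C assume "C \<in> rcosets S"
      then obtain g where g: "g \<in> carrier G" "C = S #> g" by (auto simp: RCOSETS_def)
      have "C #> h = S #> (g \<otimes> h)" using g h S.subset by (simp add: coset_mult_assoc)
      then show "D (C #> h) = \<phi> (D C) \<otimes>\<^bsub>?Z\<^esub> d h" using D g h d_mult[OF g(1) h] by (simp add: \<phi>_def)
    qed simp
    also have "\<dots> = finprod ?Z (\<lambda>C. \<phi> (D C)) (rcosets S) \<otimes>\<^bsub>?Z\<^esub> finprod ?Z (\<lambda>C. d h) (rcosets S)"
      using DA A_conj[OF _ h] dA[OF h] by (intro Z.finprod_multf) (auto simp: \<phi>_def)
    also have "finprod ?Z (\<lambda>C. \<phi> (D C)) (rcosets S) = \<phi> a"
      unfolding a_def using Z.finprod_endomorphism[OF \<phi> finR, of D] DA by simp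
    also have "finprod ?Z (\<lambda>C. d h) (rcosets S) = d h [^] card (rcosets S)"
      using Z.finprod_const[of "d h" "rcosets S"] dA[OF h] Zpow by simp
    finally have "a = (inv h \<otimes> a \<otimes> h) \<otimes> d h [^] card (rcosets S)" by (simp add: \<phi>_def)
    then have "inv (inv h \<otimes> a \<otimes> h) \<otimes> a = d h [^] card (rcosets S)"
      using ac h dc[OF h] by (metis inv_closed m_closed mult_inv_cancel_left(2) nat_pow_closed)
    then show ?thesis using ac h by (simp add: inv_mult_group m_assoc)
  qed
  obtain u where "[card (rcosets S) * u = 1] (mod p ^ k)"
    using cong_solve_coprime_nat[of "card (rcosets S)" "p ^ k"] idx by (auto simp: coprime_commute)
  define b where "b = a [^] u"
  have bc: "b \<in> carrier G" using ac by (simp add: b_def)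
  have "f h = inv b \<otimes> h \<otimes> b" if h: "h \<in> carrier G" for h
  proof -
    let ?x = "inv h \<otimes> inv a \<otimes> h"
    have "?x \<in> A" using A_conj[OF _ h] aA subgroup.m_inv_closed[OF subA] by blast
    then have com: "?x \<otimes> a = a \<otimes> ?x" using Acomm AN[OF aA] by blast
    have "d h = d h [^] (card (rcosets S) * u)"
      using pow_cong[OF dc[OF h] dp[OF h] \<open>[card (rcosets S) * u = 1] (mod p ^ k)\<close>] dc[OF h] by simp
    also have "\<dots> = (?x \<otimes> a) [^] u" using key[OF h] dc[OF h] by (simp add: nat_pow_pow[symmetric])
    also have "\<dots> = ?x [^] u \<otimes> a [^] u" using pow_mult_distrib[OF com] ac h by simp
    also have "?x [^] u = inv h \<otimes> inv b \<otimes> h" using conj_nat_pow[of h "inv a" u] h ac by (simp add: b_def nat_pow_inv)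
    finally have "d h = inv h \<otimes> inv b \<otimes> h \<otimes> b" by (simp add: b_def)
    then show ?thesis using fd[OF h] h bc by (simp add: m_assoc mult_inv_cancel_left)
  qed
  then show ?thesis using that bc by blast
qed

section \<open>Automorphisms of prime power order\<close>

lemma (in group) AutoGroup_pow_apply:
  assumes "\<sigma> \<in> auto G" "x \<in> carrier G"
  shows "(\<sigma> [^]\<^bsub>AutoGroup G\<^esub> (n::nat)) x = (\<sigma> ^^ n) x"
  using assms(2)
proof (induction n arbitrary: x)
  case 0
  then show ?case by (simp add: AutoGroup_def BijGroup_def)
next
  case (Suc n)
  interpret A: group "AutoGroup G" by (rule AutoGroup)
  have car: "carrier (AutoGroup G) = auto G" by (simp add: AutoGroup_def)
  have pw: "\<sigma> [^]\<^bsub>AutoGroup G\<^esub> n \<in> auto G" using A.nat_pow_closed[of \<sigma> n] assms(1) car by simp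
  have sx: "\<sigma> x \<in> carrier G" using assms(1) Suc.prems by (auto simp: auto_def hom_def)
  have "(\<sigma> [^]\<^bsub>AutoGroup G\<^esub> Suc n) x = (\<sigma> [^]\<^bsub>AutoGroup G\<^esub> n) (\<sigma> x)"
    using assms(1) pw Suc.prems by (simp add: AutoGroup_def BijGroup_def auto_def compose_def)
  also have "\<dots> = (\<sigma> ^^ Suc n) x" using Suc.IH[OF sx] by (simp add: funpow_Suc_right del: funpow.simps)
  finally show ?case .
qed

lemma (in group) funpow_ord_automorphism:
  assumes "\<sigma> \<in> auto G" "x \<in> carrier G"
  shows "(\<sigma> ^^ group.ord (AutoGroup G) \<sigma>) x = x"
proof -
  interpret A: group "AutoGroup G" by (rule AutoGroup)
  have "\<sigma> \<in> carrier (AutoGroup G)" using assms(1) by (simp add: AutoGroup_def)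
  then have "\<sigma> [^]\<^bsub>AutoGroup G\<^esub> A.ord \<sigma> = \<one>\<^bsub>AutoGroup G\<^esub>" by (rule A.pow_ord_eq_1)
  then show ?thesis
    using AutoGroup_pow_apply[OF assms, of "A.ord \<sigma>"] assms(2) by (simp add: AutoGroup_def BijGroup_def)
qed

lemma funpow_cong:
  assumes "(f ^^ n) x = x" "[i = j] (mod n)"
  shows "(f ^^ i) x = (f ^^ j) x"
  using assms by (metis cong_def funpow_mod_eq)

lemma (in group) conj_hom:
  assumes "f \<in> hom G G" "w \<in> carrier G"
  shows "(\<lambda>x. w \<otimes> f x \<otimes> inv w) \<in> hom G G"
proof (rule homI)
  fix x y assume "x \<in> carrier G" "y \<in> carrier G"
  moreover have "f x \<in> carrier G" "f y \<in> carrier G" "f (x \<otimes> y) = f x \<otimes> f y"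
    using assms(1) calculation by (auto simp: hom_def)
  ultimately show "w \<otimes> f (x \<otimes> y) \<otimes> inv w = w \<otimes> f x \<otimes> inv w \<otimes> (w \<otimes> f y \<otimes> inv w)"
    using assms(2) by (simp add: m_assoc mult_inv_cancel_left)
qed (use assms in \<open>auto simp: hom_def\<close>)

lemma funpow_closed:
  assumes "f \<in> hom G G" "x \<in> carrier G"
  shows "(f ^^ n) x \<in> carrier G"
  using assms by (induction n) (auto simp: hom_def)

text \<open>Conjugating \<open>f\<close> back by \<open>g\<close> gives a map \<open>t\<close> that fixes \<open>S\<close> but may have lost its \<open>p\<close>-power order. All
powers of \<open>t\<close> differ from those of \<open>f\<close> by conjugations, so the \<open>p ^ k\<close>-th power is a conjugation and
some multiple of \<open>p ^ k\<close> is a period of \<open>t\<close>. The \<open>p\<close>-part \<open>t ^^ u\<close> of \<open>t\<close>, with \<open>u\<close> congruent to \<open>1\<close>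
modulo \<open>p ^ k\<close>, still fixes \<open>S\<close>; and since \<open>f ^^ u = f\<close> on \<open>G\<close>, it is again \<open>f\<close> followed by a
single conjugation.\<close>

lemma (in group) normalise_on_subgroup:
  assumes fin: "finite (carrier G)" and p: "Factorial_Ring.prime (p::nat)"
    and f: "f \<in> hom G G" and per: "\<And>x. x \<in> carrier G \<Longrightarrow> (f ^^ (p ^ k)) x = x"
    and S: "S \<subseteq> carrier G" and g: "g \<in> carrier G" and fS: "\<And>x. x \<in> S \<Longrightarrow> f x = inv g \<otimes> x \<otimes> g"
  obtains w l where "w \<in> carrier G" "\<And>x. x \<in> S \<Longrightarrow> w \<otimes> f x \<otimes> inv w = x"
    "\<And>x. x \<in> carrier G \<Longrightarrow> ((\<lambda>x. w \<otimes> f x \<otimes> inv w) ^^ (p ^ l)) x = x"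
proof -
  interpret f: group_hom G G f using f by unfold_locales
  define t where "t = (\<lambda>x. g \<otimes> f x \<otimes> inv g)"
  have t: "t \<in> hom G G" unfolding t_def by (rule conj_hom[OF f g])
  have tS: "(t ^^ j) x = x" if "x \<in> S" for x j
    using that S g fS[OF that] by (induction j) (auto simp: t_def m_assoc mult_inv_cancel_left subset_iff)
  have it: "\<exists>w\<in>carrier G. \<forall>x\<in>carrier G. (t ^^ j) x = w \<otimes> (f ^^ j) x \<otimes> inv w" for j
  proof (induction j)
    case 0
    then show ?case by (intro bexI[of _ \<one>]) auto
  next
    case (Suc j)
    then obtain w where w: "w \<in> carrier G" "\<And>x. x \<in> carrier G \<Longrightarrow> (t ^^ j) x = w \<otimes> (f ^^ j) x \<otimes> inv w"
      by blast
    have "(t ^^ Suc j) x = (g \<otimes> f w) \<otimes> (f ^^ Suc j) x \<otimes> inv (g \<otimes> f w)" if x: "x \<in> carrier G" for x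
      using w x g funpow_closed[OF f x, of j] by (simp add: t_def m_assoc inv_mult_group)
    then show ?case using w(1) g by (intro bexI[of _ "g \<otimes> f w"]) auto
  qed
  obtain v where v: "v \<in> carrier G" "\<And>x. x \<in> carrier G \<Longrightarrow> (t ^^ (p ^ k)) x = v \<otimes> x \<otimes> inv v"
    using it[of "p ^ k"] per by auto
  have vi: "(t ^^ (p ^ k * i)) x = v [^] i \<otimes> x \<otimes> inv (v [^] i)" if x: "x \<in> carrier G" for x i
  proof (induction i)
    case 0
    then show ?case using x by simp
  next
    case (Suc i)
    have "(t ^^ (p ^ k * Suc i)) x = (t ^^ (p ^ k)) ((t ^^ (p ^ k * i)) x)"
      by (simp add: funpow_add)
    also have "\<dots> = v \<otimes> (v [^] i \<otimes> x \<otimes> inv (v [^] i)) \<otimes> inv v" using Suc v x by simp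
    also have "\<dots> = (v \<otimes> v [^] i) \<otimes> x \<otimes> inv (v \<otimes> v [^] i)" using v(1) x by (simp add: m_assoc inv_mult_group)
    finally show ?case using nat_pow_Suc2[OF v(1)] by simp
  qed
  have o: "order G \<noteq> 0" using fin by (auto simp: order_def)
  define a where "a = multiplicity p (order G)"
  obtain m where m: "order G = p ^ a * m" "\<not> p dvd m"
    using multiplicity_decompose'[of "order G" p] o p by (metis a_def not_prime_unit)
  have tper: "(t ^^ (p ^ (k + a) * m)) x = x" if x: "x \<in> carrier G" for x
    using vi[OF x, of "order G"] pow_order_eq_1[OF v(1)] x m(1) by (simp add: power_add mult.assoc)
  have "coprime (p ^ (k + a)) m" using m(2) p by (simp add: prime_imp_coprime)
  then obtain u where u: "[u = 1] (mod p ^ (k + a))" "[u = 0] (mod m)"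
    using binary_chinese_remainder_nat[of "p ^ (k + a)" m 1 0] by auto
  obtain w where w: "w \<in> carrier G" "\<And>x. x \<in> carrier G \<Longrightarrow> (t ^^ u) x = w \<otimes> (f ^^ u) x \<otimes> inv w"
    using it[of u] by blast
  have "[u = 1] (mod p ^ k)" using u(1) by (metis cong_dvd_modulus_nat le_add1 le_imp_power_dvd)
  then have fu: "(f ^^ u) x = f x" if "x \<in> carrier G" for x
    using funpow_cong[OF per[OF that]] by fastforce
  have tu: "(t ^^ u) x = w \<otimes> f x \<otimes> inv w" if "x \<in> carrier G" for x using w fu that by simp
  have pw: "((\<lambda>x. w \<otimes> f x \<otimes> inv w) ^^ j) x = (t ^^ (u * j)) x" if x: "x \<in> carrier G" for j x
  proof (induction j)
    case (Suc j)
    then show ?case using tu[OF funpow_closed[OF t x, of "u * j"]] by (simp add: funpow_add)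
  qed simp
  show ?thesis
  proof (rule that[OF w(1)])
    show "w \<otimes> f x \<otimes> inv w = x" if "x \<in> S" for x using tu tS that S by (metis subsetD)
    show "((\<lambda>x. w \<otimes> f x \<otimes> inv w) ^^ (p ^ (k + a))) x = x" if x: "x \<in> carrier G" for x
    proof -
      have "[u * p ^ (k + a) = 0] (mod p ^ (k + a) * m)" using u(2) by (simp add: cong_0_iff mult.commute)
      then show ?thesis using pw[OF x] funpow_cong[OF tper[OF x]] by (metis funpow_0)
    qed
  qed
qed

section \<open>Automorphisms fixing a Sylow subgroup pointwise\<close>

text \<open>The situation after normalisation. The element \<open>c\<close> generates \<open>S\<close> modulo \<open>N\<close>, which is the form in
which cyclicity of the Sylow subgroup of the quotient is used. The Coleman property is stated for all
primes \<open>q\<close>; for those that do not divide the order of \<open>G\<close> it only speaks about the trivial subgroup.\<close>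

locale sylow_fixing_automorphism = normal N G for N and G (structure) +
  fixes p :: nat and S :: "'a set" and c :: 'a and f :: "'a \<Rightarrow> 'a" and k :: nat
  assumes fin: "finite (carrier G)" and p: "Factorial_Ring.prime p"
    and nilN: "nilpotent_group (G\<lparr>carrier := N\<rparr>)" and nilQ: "nilpotent_group (G Mod N)"
    and S: "sylow_subgroup G p S"
    and SN_comm: "\<And>y z. y \<in> S \<inter> N \<Longrightarrow> z \<in> S \<inter> N \<Longrightarrow> y \<otimes> z = z \<otimes> y"
    and c: "c \<in> S" and S_gen: "\<And>z. z \<in> S \<Longrightarrow> \<exists>j::nat. inv (c [^] j) \<otimes> z \<in> N"
    and f: "f \<in> hom G G" and fS: "\<And>z. z \<in> S \<Longrightarrow> f z = z"
    and per: "\<And>g. g \<in> carrier G \<Longrightarrow> (f ^^ (p ^ k)) g = g"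
    and class_preserving: "\<And>g. g \<in> carrier G \<Longrightarrow> \<exists>u\<in>carrier G. f g = inv u \<otimes> g \<otimes> u"
    and coleman: "\<And>q R. Factorial_Ring.prime q \<Longrightarrow> sylow_subgroup G q R \<Longrightarrow>
      \<exists>u\<in>carrier G. \<forall>y\<in>R. f y = inv u \<otimes> y \<otimes> u"
begin

abbreviation "K \<equiv> G\<lparr>carrier := N\<rparr>"

lemma S_subgroup: "subgroup S G" using S by (simp add: sylow_subgroup_def)

lemma S_carrier: "s \<in> S \<Longrightarrow> s \<in> carrier G" using S_subgroup subgroup.mem_carrier by metis

lemma group_K: "group K" using subgroup_imp_group is_subgroup by blast

lemma K_pow: "x [^]\<^bsub>K\<^esub> (n::nat) = x [^] n" by (simp add: nat_pow_consistent[symmetric])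

lemma K_inv: "x \<in> N \<Longrightarrow> inv\<^bsub>K\<^esub> x = inv x" by (rule m_inv_consistent[OF is_subgroup])

lemma finite_K: "finite (carrier K)" using fin subset finite_subset by auto

lemma S_card: "\<exists>a. card S = p ^ a" using S by (auto simp: sylow_subgroup_def)

lemma p_elements_of_N:
  assumes "x \<in> N" "x [^] (p ^ j) = \<one>"
  shows "x \<in> S \<inter> N"
  using nilpotent_sylow_contains[OF nilN finite_K p sylow_inter_image(1)[OF fin p S], of x j] assms K_pow
  by simp

text \<open>Sylow subgroups consist of elements of prime power order, so these elements generate \<open>N\<close>.\<close>

lemma N_eqI:
  assumes H: "subgroup H K"
    and q: "\<And>q j x. \<lbrakk>Factorial_Ring.prime (q::nat); x \<in> N; x [^] (q ^ j) = \<one>\<rbrakk> \<Longrightarrow> x \<in> H"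
  shows "H = N"
proof -
  interpret K: group K by (rule group_K)
  have "H = carrier K"
  proof (rule K.subgroup_containing_sylows[OF finite_K H])
    fix q :: nat assume q1: "Factorial_Ring.prime q"
    obtain R where R: "sylow_subgroup K q R" using K.sylow_subgroup_exists[OF finite_K q1] .
    then have RK: "subgroup R K" "card R = q ^ multiplicity q (order K)" by (auto simp: sylow_subgroup_def)
    have "x \<in> H" if x: "x \<in> R" for x
    proof -
      have "x [^] (q ^ multiplicity q (order K)) = \<one>" using K.subgroup_pow_card[OF RK(1) x] RK(2) K_pow by simp
      moreover have "x \<in> N" using x subgroup.subset[OF RK(1)] by auto
      ultimately show ?thesis using q q1 by blast
    qed
    then show "\<exists>R. sylow_subgroup K q R \<and> R \<subseteq> H" using R by blast
  qed
  then show ?thesis by simp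
qed

text \<open>The centraliser of \<open>y\<close> contains the elements of \<open>N\<close> of \<open>p\<close>-power order, as these form an abelian group,
and those of order prime to \<open>p\<close>, as \<open>N\<close> is nilpotent.\<close>

lemma SN_central:
  assumes y: "y \<in> S \<inter> N" and n: "n \<in> N"
  shows "y \<otimes> n = n \<otimes> y"
proof -
  interpret K: group K by (rule group_K)
  have yN: "y \<in> N" "y \<in> carrier G" using y by auto
  define H where "H = {n \<in> N. y \<otimes> n = n \<otimes> y}"
  have "subgroup H K"
  proof (rule K.subgroupI)
    show "H \<subseteq> carrier K" by (auto simp: H_def)
    show "H \<noteq> {}" using yN by (auto simp: H_def)
    show "inv\<^bsub>K\<^esub> n \<in> H" if "n \<in> H" for n
      using that commute_inv[of y n] yN K_inv[of n] by (simp add: H_def)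
    show "m \<otimes>\<^bsub>K\<^esub> n \<in> H" if m: "m \<in> H" and n: "n \<in> H" for m n
    proof -
      have mn: "m \<in> N" "n \<in> N" "m \<in> carrier G" "n \<in> carrier G" "y \<otimes> m = m \<otimes> y" "y \<otimes> n = n \<otimes> y"
        using m n by (auto simp: H_def)
      show ?thesis using commute_mult[OF yN(2) mn(3-6)] mn by (simp add: H_def)
    qed
  qed
  then have "H = N"
  proof (rule N_eqI)
    fix q j x assume q: "Factorial_Ring.prime (q::nat)" "x \<in> N" "x [^] (q ^ j) = \<one>"
    show "x \<in> H"
    proof (cases "q = p")
      case True
      then have "x \<in> S \<inter> N" using p_elements_of_N q by blast
      then show ?thesis using SN_comm[OF y] q by (simp add: H_def)
    next
      case False
      obtain a where a: "card S = p ^ a" using S_card by blast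
      have "y [^] (p ^ a) = \<one>" using subgroup_pow_card[OF S_subgroup, of y] y a by simp
      moreover have "coprime (p ^ a) (q ^ j)" using primes_coprime[OF p q(1)] False by simp
      ultimately have "y \<otimes> x = x \<otimes> y"
        using nilpotent_coprime_commute[OF nilN, of y "p ^ a" x "q ^ j"] yN q K_pow by simp
      then show ?thesis using q by (simp add: H_def)
    qed
  qed
  then show ?thesis using n by (auto simp: H_def)
qed

text \<open>Modulo \<open>N\<close> every element is the product of its \<open>p'\<close>-part and its \<open>p\<close>-part. The latter lies in the image of
\<open>S\<close>, since that is a Sylow subgroup of a nilpotent group.\<close>

lemma decompose:
  assumes g: "g \<in> carrier G"
  obtains h s m where "h \<in> carrier G" "s \<in> S" "g = h \<otimes> s" "h [^] (m::nat) \<in> N" "coprime p m"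
proof -
  interpret q: group_hom G "G Mod N" "\<lambda>x. N #> x" by (rule quotient_hom)
  have finQ: "finite (carrier (G Mod N))" using fin by (simp add: FactGroup_def RCOSETS_def)
  have "N #> g \<in> carrier (G Mod N)" using g q.hom_closed by blast
  from q.H.primary_decomposition[OF finQ p this] obtain a b k m where ab:
    "a \<in> carrier (G Mod N)" "b \<in> carrier (G Mod N)" "N #> g = b \<otimes>\<^bsub>G Mod N\<^esub> a"
    "a [^]\<^bsub>G Mod N\<^esub> (p ^ k) = \<one>\<^bsub>G Mod N\<^esub>" "b [^]\<^bsub>G Mod N\<^esub> m = \<one>\<^bsub>G Mod N\<^esub>" "coprime p m"
    by metis
  have "a \<in> (\<lambda>x. N #> x) ` S"
    using nilpotent_sylow_contains[OF nilQ finQ p sylow_inter_image(2)[OF fin p S] ab(1,4)] .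
  then obtain s where s: "s \<in> S" "a = N #> s" by blast
  define h where "h = g \<otimes> inv s"
  have sc: "s \<in> carrier G" and hc: "h \<in> carrier G" using s g S_carrier by (auto simp: h_def)
  have "N #> h = b \<otimes>\<^bsub>G Mod N\<^esub> a \<otimes>\<^bsub>G Mod N\<^esub> inv\<^bsub>G Mod N\<^esub> a"
    using g sc ab(3) s(2) by (simp only: h_def q.hom_mult q.hom_inv inv_closed)
  also have "\<dots> = b" using ab(1,2) by (simp only: q.H.m_assoc q.H.inv_closed q.H.r_inv q.H.r_one)
  finally have "N #> (h [^] m) = \<one>\<^bsub>G Mod N\<^esub>" using q.hom_nat_pow[OF hc, of m] ab(5) by simp
  then have "h [^] m \<in> N" using rcos_eq_one_iff[of "h [^] m"] hc by blast
  moreover have "g = h \<otimes> s" using g sc by (simp add: h_def m_assoc)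
  ultimately show ?thesis using that hc s(1) ab(6) by blast
qed

lemma f_closed: "g \<in> carrier G \<Longrightarrow> f g \<in> carrier G" using f by (auto simp: hom_def)

lemma f_mult: "g \<in> carrier G \<Longrightarrow> h \<in> carrier G \<Longrightarrow> f (g \<otimes> h) = f g \<otimes> f h" using f by (auto simp: hom_def)

text \<open>The factor of \<open>g\<close> in \<open>S\<close> is fixed by \<open>f\<close>; for the factor of order prime to \<open>p\<close> modulo \<open>N\<close>, class
preservation along a central series from \<open>G\<close> to \<open>N\<close> applies.\<close>

lemma f_mod_N:
  assumes g: "g \<in> carrier G"
  shows "inv g \<otimes> f g \<in> N"
proof -
  obtain L n where L: "central_chain G L n" "L n = N"
    using nilpotent_quotient_central_chain[OF normal_axioms nilQ] .
  obtain h s m where hs: "h \<in> carrier G" "s \<in> S" "g = h \<otimes> s" "h [^] (m::nat) \<in> N" "coprime p m"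
    using decompose[OF g] .
  have "inv h \<otimes> f h \<in> L n"
    using coprime_automorphism_mod_chain[OF L(1) f subgroup_self, of "p ^ k" m h] f_closed class_preserving per hs L(2)
    by simp
  then have "inv s \<otimes> (inv h \<otimes> f h) \<otimes> s \<in> N" using L(2) S_carrier[OF hs(2)] inv_op_closed1 by blast
  also have "inv s \<otimes> (inv h \<otimes> f h) \<otimes> s = inv g \<otimes> f g"
    using hs S_carrier[OF hs(2)] f_closed[OF hs(1)] fS[OF hs(2)] f_mult by (simp add: m_assoc inv_mult_group)
  finally show ?thesis .
qed

text \<open>Modulo \<open>N\<close> the image of \<open>S\<close> is cyclic and commutes with all elements of order prime to \<open>p\<close>.\<close>

lemma S_central_mod_N:
  assumes s: "s \<in> S" and g: "g \<in> carrier G"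
  shows "(N #> s) \<otimes>\<^bsub>G Mod N\<^esub> (N #> g) = (N #> g) \<otimes>\<^bsub>G Mod N\<^esub> (N #> s)"
proof -
  interpret q: group_hom G "G Mod N" "\<lambda>x. N #> x" by (rule quotient_hom)
  have S_pow: "\<exists>j::nat. N #> z = (N #> c) [^]\<^bsub>G Mod N\<^esub> j" if "z \<in> S" for z
  proof -
    obtain j :: nat where "inv (c [^] j) \<otimes> z \<in> N" using S_gen[OF \<open>z \<in> S\<close>] by (elim exE)
    then have "N #> (c [^] j) = N #> z"
      by (rule iffD2[OF rcos_eq_iff[OF nat_pow_closed[OF S_carrier[OF c]] S_carrier[OF \<open>z \<in> S\<close>]]])
    from trans[OF sym[OF this] q.hom_nat_pow[OF S_carrier[OF c]]]
    show ?thesis by (rule exI)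
  qed
  obtain h t m where ht: "h \<in> carrier G" "t \<in> S" "g = h \<otimes> t" "h [^] (m::nat) \<in> N" "coprime p m"
    using decompose[OF g] .
  obtain a where a: "card S = p ^ a" using S_card by blast
  obtain L n where L: "central_chain G L n" "L n = N"
    using nilpotent_quotient_central_chain[OF normal_axioms nilQ] .
  have "s [^] (p ^ a) \<in> N" using subgroup_pow_card[OF S_subgroup s] a one_closed by simp
  moreover have "coprime (p ^ a) m" using ht(5) by simp
  ultimately have "inv s \<otimes> inv h \<otimes> s \<otimes> h \<in> N"
    using coprime_commute_mod_chain[OF L(1) S_carrier[OF s] ht(1)] ht(4) unfolding L(2) by blast
  then have sh: "(N #> s) \<otimes>\<^bsub>G Mod N\<^esub> (N #> h) = (N #> h) \<otimes>\<^bsub>G Mod N\<^esub> (N #> s)"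
    by (rule iffD2[OF rcos_commute_iff[OF S_carrier[OF s] ht(1)]])
  have cl: "N #> x \<in> carrier (G Mod N)" if "x \<in> carrier G" for x using that q.hom_closed by blast
  obtain i j :: nat where ij: "N #> s = (N #> c) [^]\<^bsub>G Mod N\<^esub> i" "N #> t = (N #> c) [^]\<^bsub>G Mod N\<^esub> j"
    using S_pow[OF s] S_pow[OF ht(2)] by (elim exE)
  have st: "(N #> s) \<otimes>\<^bsub>G Mod N\<^esub> (N #> t) = (N #> t) \<otimes>\<^bsub>G Mod N\<^esub> (N #> s)"
    unfolding ij using cl[OF S_carrier[OF c]] by (simp only: q.H.nat_pow_mult add.commute)
  have "N #> g = (N #> h) \<otimes>\<^bsub>G Mod N\<^esub> (N #> t)"
    unfolding ht(3) by (rule q.hom_mult[OF ht(1) S_carrier[OF ht(2)]])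
  then show ?thesis
    using q.H.commute_mult[OF cl[OF S_carrier[OF s]] cl[OF ht(1)] cl[OF S_carrier[OF ht(2)]] sh st] by simp
qed

definition twist :: "'a \<Rightarrow> 'a \<Rightarrow> 'a" where "twist s y = s \<otimes> f y \<otimes> inv s"

definition N_conj :: "'a \<Rightarrow> 'a \<Rightarrow> bool" where
  "N_conj y z \<longleftrightarrow> (\<exists>n\<in>N. z = inv n \<otimes> y \<otimes> n)"

lemma N_conj_refl: "y \<in> carrier G \<Longrightarrow> N_conj y y"
  unfolding N_conj_def by (intro bexI[of _ \<one>]) auto

lemma N_conj_trans:
  assumes "y \<in> carrier G" "N_conj y z" "N_conj z w"
  shows "N_conj y w"
proof -
  obtain m n where mn: "m \<in> N" "n \<in> N" "z = inv m \<otimes> y \<otimes> m" "w = inv n \<otimes> z \<otimes> n"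
    using assms by (auto simp: N_conj_def)
  then have "w = inv (m \<otimes> n) \<otimes> y \<otimes> (m \<otimes> n)" using assms(1) by (simp add: inv_mult_group m_assoc)
  then show ?thesis using mn unfolding N_conj_def by blast
qed

lemma N_conj_sym:
  assumes "y \<in> carrier G" "N_conj y z"
  shows "N_conj z y"
proof -
  obtain n where n: "n \<in> N" "z = inv n \<otimes> y \<otimes> n" using assms by (auto simp: N_conj_def)
  then have "y = inv (inv n) \<otimes> z \<otimes> inv n" using assms(1) by (simp add: m_assoc mult_inv_cancel_left)
  then show ?thesis using n unfolding N_conj_def by blast
qed

lemma N_conj_conj:
  assumes y: "y \<in> carrier G" and yz: "N_conj y z" and g: "g \<in> carrier G"
  shows "N_conj (g \<otimes> y \<otimes> inv g) (g \<otimes> z \<otimes> inv g)"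
proof -
  obtain n where n: "n \<in> N" "z = inv n \<otimes> y \<otimes> n" using yz by (auto simp: N_conj_def)
  have "g \<otimes> z \<otimes> inv g = inv (g \<otimes> n \<otimes> inv g) \<otimes> (g \<otimes> y \<otimes> inv g) \<otimes> (g \<otimes> n \<otimes> inv g)"
    using n y g by (simp add: inv_mult_group m_assoc mult_inv_cancel_left)
  then show ?thesis using inv_op_closed2[OF g n(1)] unfolding N_conj_def by blast
qed

lemma twist_hom: "s \<in> S \<Longrightarrow> twist s \<in> hom G G"
  unfolding twist_def using conj_hom[OF f] S_carrier by blast

text \<open>As \<open>f\<close> fixes \<open>s\<close>, it commutes with conjugation by \<open>s\<close>, and both have \<open>p\<close>-power order. The period can be
chosen independently of \<open>s\<close>.\<close>

lemma twist_period:
  obtains l where "\<And>s y. s \<in> S \<Longrightarrow> y \<in> carrier G \<Longrightarrow> (twist s ^^ (p ^ l)) y = y"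
proof -
  obtain a where a: "card S = p ^ a" using S_card by blast
  have "(twist s ^^ (p ^ (k + a))) y = y" if s: "s \<in> S" and y: "y \<in> carrier G" for s y
  proof -
    have sc: "s \<in> carrier G" using S_carrier s by blast
    have it: "(twist s ^^ i) y = s [^] i \<otimes> (f ^^ i) y \<otimes> inv (s [^] i)" for i
    proof (induction i)
      case (Suc i)
      interpret f: group_hom G G f using f by unfold_locales
      have "f (s [^] i) = s [^] i" using f.hom_nat_pow[OF sc] fS[OF s] by simp
      moreover have "(twist s ^^ Suc i) y = twist s (s [^] i \<otimes> (f ^^ i) y \<otimes> inv (s [^] i))" using Suc by simp
      ultimately have "(twist s ^^ Suc i) y = (s \<otimes> s [^] i) \<otimes> (f ^^ Suc i) y \<otimes> inv (s \<otimes> s [^] i)"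
        using sc funpow_closed[OF f y, of i] by (simp add: twist_def m_assoc inv_mult_group)
      then show ?case using nat_pow_Suc2[OF sc] by simp
    qed (use y in simp)
    have "s [^] (p ^ (k + a)) = \<one>"
      using subgroup_pow_card[OF S_subgroup s] a sc by (simp add: power_add mult.commute nat_pow_pow[symmetric])
    moreover have "(f ^^ (p ^ (k + a))) y = y"
      using funpow_cong[OF per[OF y], of "p ^ (k + a)" 0] by (simp add: power_add cong_0_iff)
    ultimately show ?thesis using it[of "p ^ (k + a)"] y by simp
  qed
  then show ?thesis using that by blast
qed

lemma twist_mod_N:
  assumes s: "s \<in> S" and y: "y \<in> carrier G"
  shows "inv y \<otimes> twist s y \<in> N"
proof -
  interpret q: group_hom G "G Mod N" "\<lambda>x. N #> x" by (rule quotient_hom)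
  have sc: "s \<in> carrier G" using S_carrier s by blast
  have cl: "N #> x \<in> carrier (G Mod N)" if "x \<in> carrier G" for x using that q.hom_closed by blast
  have fy: "N #> f y = N #> y" using rcos_eq_iff[OF y f_closed[OF y]] f_mod_N[OF y] by simp
  have "N #> twist s y = (N #> s) \<otimes>\<^bsub>G Mod N\<^esub> (N #> y) \<otimes>\<^bsub>G Mod N\<^esub> inv\<^bsub>G Mod N\<^esub> (N #> s)"
    using sc f_closed[OF y] fy by (simp only: twist_def q.hom_mult q.hom_inv inv_closed m_closed)
  also have "\<dots> = N #> y"
    using S_central_mod_N[OF s y] cl[OF sc] cl[OF y] by (metis q.H.inv_solve_right q.H.m_closed)
  finally show ?thesis using rcos_eq_iff[OF y, of "twist s y"] sc f_closed[OF y] by (simp add: twist_def)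
qed

lemma twist_N:
  assumes "s \<in> S" "y \<in> N"
  shows "twist s y \<in> N"
proof -
  have yc: "y \<in> carrier G" using assms by simp
  then have tc: "twist s y \<in> carrier G" using twist_hom[OF assms(1)] by (auto simp: hom_def)
  have "y \<otimes> (inv y \<otimes> twist s y) \<in> N" using twist_mod_N[OF assms(1) yc] assms(2) by simp
  then show ?thesis using yc tc by (simp add: mult_inv_cancel_left)
qed

lemma N_conj_twist:
  assumes s: "s \<in> S" and y: "y \<in> carrier G" and yz: "N_conj y z"
  shows "N_conj (twist s y) (twist s z)"
proof -
  interpret t: group_hom G G "twist s" using twist_hom[OF s] by unfold_locales
  obtain n where n: "n \<in> N" "z = inv n \<otimes> y \<otimes> n" using yz by (auto simp: N_conj_def)
  then have "twist s z = inv (twist s n) \<otimes> twist s y \<otimes> twist s n" using y by simp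
  then show ?thesis using twist_N[OF s n(1)] unfolding N_conj_def by blast
qed

text \<open>On \<open>N\<close>-classes \<open>twist s\<close> commutes with conjugation by \<open>h\<close>, because it is trivial modulo \<open>N\<close>. So its
\<open>i\<close>-th iterate takes the class of \<open>y\<close> to the class conjugated by the \<open>i\<close>-th power of \<open>h\<close>; in
particular the \<open>m\<close>-th iterate fixes the class. As \<open>twist s\<close> has \<open>p\<close>-power order and \<open>m\<close> is prime to
\<open>p\<close>, it fixes the class itself.\<close>

lemma twist_preserves_class:
  assumes s: "s \<in> S" and h: "h \<in> carrier G" "h [^] (m::nat) \<in> N" "coprime p m"
    and y: "y \<in> carrier G" and ty: "twist s y = inv h \<otimes> y \<otimes> h"
  shows "N_conj y (twist s y)"
proof -
  interpret t: group_hom G G "twist s" using twist_hom[OF s] by unfold_locales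
  have tc: "(twist s ^^ i) y \<in> carrier G" for i using funpow_closed[OF twist_hom[OF s] y] .
  have it: "N_conj (inv (h [^] i) \<otimes> y \<otimes> h [^] i) ((twist s ^^ i) y)" for i
  proof (induction i)
    case 0
    then show ?case using N_conj_refl y by simp
  next
    case (Suc i)
    let ?w = "h [^] i"
    have w: "?w \<in> carrier G" using h by simp
    have "N_conj (twist s (inv ?w \<otimes> y \<otimes> ?w)) ((twist s ^^ Suc i) y)"
      using N_conj_twist[OF s _ Suc] w y by simp
    moreover have "N_conj (inv (h [^] Suc i) \<otimes> y \<otimes> h [^] Suc i) (twist s (inv ?w \<otimes> y \<otimes> ?w))"
    proof -
      define n where "n = inv ?w \<otimes> twist s ?w"
      have n: "n \<in> N" "n \<in> carrier G" using twist_mod_N[OF s w] by (auto simp: n_def)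
      have "twist s ?w = ?w \<otimes> n" using w t.hom_closed[OF w] by (simp add: n_def mult_inv_cancel_left)
      then have "twist s (inv ?w \<otimes> y \<otimes> ?w) = inv (?w \<otimes> n) \<otimes> (inv h \<otimes> y \<otimes> h) \<otimes> (?w \<otimes> n)"
        using w y ty by simp
      also have "\<dots> = inv n \<otimes> (inv (h \<otimes> ?w) \<otimes> y \<otimes> (h \<otimes> ?w)) \<otimes> n"
        using w y h n by (simp add: inv_mult_group m_assoc)
      finally show ?thesis using n(1) nat_pow_Suc2[OF h(1)] unfolding N_conj_def by auto
    qed
    ultimately show ?case using N_conj_trans h y by (meson inv_closed m_closed nat_pow_closed)
  qed
  have "N_conj y (inv (h [^] m) \<otimes> y \<otimes> h [^] m)" using h(2) unfolding N_conj_def by blast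
  then have tm: "N_conj y ((twist s ^^ m) y)" using N_conj_trans[OF y _ it[of m]] by blast
  have tmj: "N_conj y ((twist s ^^ (m * j)) y)" for j
  proof (induction j)
    case 0
    then show ?case using N_conj_refl[OF y] by simp
  next
    case (Suc j)
    have "N_conj ((twist s ^^ i) y) ((twist s ^^ i) ((twist s ^^ (m * j)) y))" for i
      using N_conj_twist[OF s] tc Suc by (induction i) auto
    from this[of m] have "N_conj ((twist s ^^ m) y) ((twist s ^^ (m * Suc j)) y)" by (simp add: funpow_add)
    then show ?case using N_conj_trans[OF y tm] by blast
  qed
  obtain l where l: "(twist s ^^ (p ^ l)) y = y" using twist_period s y by metis
  obtain u where "[m * u = 1] (mod p ^ l)"
    using cong_solve_coprime_nat[of m "p ^ l"] h(3) by (auto simp: coprime_commute)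
  then have "(twist s ^^ (m * u)) y = twist s y" using funpow_cong[OF l] by fastforce
  then show ?thesis using tmj[of u] by simp
qed

definition primary_elements :: "'a set" where
  "primary_elements = {y \<in> N. \<exists>q j. Factorial_Ring.prime (q::nat) \<and> y [^] (q ^ j) = \<one>}"

lemma primary_elements_carrier: "y \<in> primary_elements \<Longrightarrow> y \<in> carrier G"
  by (auto simp: primary_elements_def)

text \<open>Elements belonging to the same prime lie in one Sylow subgroup of \<open>G\<close>, where the Coleman property
applies. Elements belonging to different primes commute and are both powers of their product, to
which class preservation applies.\<close>

lemma common_conjugator:
  assumes y: "y \<in> primary_elements" and y': "y' \<in> primary_elements"
  obtains u where "u \<in> carrier G" "f y = inv u \<otimes> y \<otimes> u" "f y' = inv u \<otimes> y' \<otimes> u"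
proof -
  obtain q j where q: "y \<in> N" "Factorial_Ring.prime (q::nat)" "y [^] (q ^ j) = \<one>"
    using y by (auto simp: primary_elements_def)
  obtain q' j' where q': "y' \<in> N" "Factorial_Ring.prime (q'::nat)" "y' [^] (q' ^ j') = \<one>"
    using y' by (auto simp: primary_elements_def)
  have car: "y \<in> carrier G" "y' \<in> carrier G" using q(1) q'(1) by auto
  show ?thesis
  proof (cases "q = q'")
    case True
    obtain R where R: "sylow_subgroup G q R" using sylow_subgroup_exists[OF fin q(2)] .
    have RN: "sylow_subgroup K q (R \<inter> N)" using sylow_inter_image(1)[OF fin q(2) R] .
    have "x \<in> R" if "x \<in> N" "x [^] (q ^ i) = \<one>" for x i
      using nilpotent_sylow_contains[OF nilN finite_K q(2) RN, of x i] that K_pow by simp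
    then have "y \<in> R" "y' \<in> R" using q q' True by blast+
    then show ?thesis using coleman[OF q(2) R] that by blast
  next
    case False
    have cop: "coprime (q ^ j) (q' ^ j')" using primes_coprime[OF q(2) q'(2) False] by simp
    have com: "y \<otimes> y' = y' \<otimes> y"
      using nilpotent_coprime_commute[OF nilN _ _ _ _ cop, of y y'] q(1,3) q'(1,3) K_pow by simp
    obtain u where u: "u \<in> carrier G" "f (y \<otimes> y') = inv u \<otimes> (y \<otimes> y') \<otimes> u"
      using class_preserving car by blast
    interpret f: group_hom G G f using f by unfold_locales
    have split: "f z = inv u \<otimes> z \<otimes> u" if e: "(y \<otimes> y') [^] (e::nat) = z" for e z
    proof -
      have "f z = (f (y \<otimes> y')) [^] e" using f.hom_nat_pow[of "y \<otimes> y'" e] car e by simp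
      also have "\<dots> = inv u \<otimes> z \<otimes> u" using conj_nat_pow[of u "y \<otimes> y'" e] u car e by simp
      finally show ?thesis .
    qed
    obtain e where e: "[e = 1] (mod q ^ j)" "[e = 0] (mod q' ^ j')"
      using binary_chinese_remainder_nat[OF cop] by blast
    obtain e' where e': "[e' = 0] (mod q ^ j)" "[e' = 1] (mod q' ^ j')"
      using binary_chinese_remainder_nat[OF cop] by blast
    have "(y \<otimes> y') [^] e = y"
      using pow_mult_distrib[OF com car] pow_cong[OF car(1) q(3) e(1)] pow_cong[OF car(2) q'(3) e(2)] car by simp
    moreover have "(y \<otimes> y') [^] e' = y'"
      using pow_mult_distrib[OF com car] pow_cong[OF car(1) q(3) e'(1)] pow_cong[OF car(2) q'(3) e'(2)] car by simp
    ultimately show ?thesis using that[OF u(1)] split by blast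
  qed
qed

lemma common_twist:
  assumes y: "y \<in> primary_elements" and y': "y' \<in> primary_elements"
  obtains s where "s \<in> S" "N_conj y (twist s y)" "N_conj y' (twist s y')"
proof -
  obtain u where u: "u \<in> carrier G" "f y = inv u \<otimes> y \<otimes> u" "f y' = inv u \<otimes> y' \<otimes> u"
    using common_conjugator[OF y y'] .
  obtain h s m where hs: "h \<in> carrier G" "s \<in> S" "u = h \<otimes> s" "h [^] (m::nat) \<in> N" "coprime p m"
    using decompose[OF u(1)] .
  have sc: "s \<in> carrier G" using S_carrier hs(2) .
  have "N_conj z (twist s z)" if z: "z \<in> carrier G" "f z = inv u \<otimes> z \<otimes> u" for z
  proof (rule twist_preserves_class[OF hs(2,1,4,5) z(1)])
    show "twist s z = inv h \<otimes> z \<otimes> h"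
      using z hs(1) sc by (simp add: twist_def hs(3) inv_mult_group m_assoc mult_inv_cancel_left)
  qed
  then show ?thesis using that hs(2) u y y' primary_elements_carrier by blast
qed

definition class_stabilizer :: "'a \<Rightarrow> 'a set" where
  "class_stabilizer y = {z \<in> S. N_conj y (z \<otimes> y \<otimes> inv z)}"

lemma class_stabilizer_subgroup:
  assumes y: "y \<in> carrier G"
  shows "subgroup (class_stabilizer y) G"
proof (rule subgroupI)
  show "class_stabilizer y \<subseteq> carrier G" using S_carrier by (auto simp: class_stabilizer_def)
  have "\<one> \<in> class_stabilizer y"
    using y N_conj_refl[OF y] subgroup.one_closed[OF S_subgroup] by (simp add: class_stabilizer_def)
  then show "class_stabilizer y \<noteq> {}" by blast
  show "inv z \<in> class_stabilizer y" if "z \<in> class_stabilizer y" for z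
  proof -
    have z: "z \<in> S" "z \<in> carrier G" "N_conj y (z \<otimes> y \<otimes> inv z)" using that S_carrier by (auto simp: class_stabilizer_def)
    have "N_conj (inv z \<otimes> y \<otimes> inv (inv z)) (inv z \<otimes> (z \<otimes> y \<otimes> inv z) \<otimes> inv (inv z))"
      using N_conj_conj[OF y z(3), of "inv z"] z(2) by blast
    also have "inv z \<otimes> (z \<otimes> y \<otimes> inv z) \<otimes> inv (inv z) = y" using z y by (simp add: m_assoc mult_inv_cancel_left)
    finally have "N_conj y (inv z \<otimes> y \<otimes> inv (inv z))" using N_conj_sym z y by simp
    then show ?thesis using z subgroup.m_inv_closed[OF S_subgroup] by (simp add: class_stabilizer_def)
  qed
  show "z \<otimes> w \<in> class_stabilizer y" if "z \<in> class_stabilizer y" "w \<in> class_stabilizer y" for z w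
  proof -
    have z: "z \<in> S" "z \<in> carrier G" "N_conj y (z \<otimes> y \<otimes> inv z)" using that S_carrier by (auto simp: class_stabilizer_def)
    have w: "w \<in> S" "w \<in> carrier G" "N_conj y (w \<otimes> y \<otimes> inv w)" using that S_carrier by (auto simp: class_stabilizer_def)
    have "N_conj (z \<otimes> y \<otimes> inv z) (z \<otimes> (w \<otimes> y \<otimes> inv w) \<otimes> inv z)" using N_conj_conj[OF y w(3) z(2)] .
    also have "z \<otimes> (w \<otimes> y \<otimes> inv w) \<otimes> inv z = (z \<otimes> w) \<otimes> y \<otimes> inv (z \<otimes> w)"
      using z w y by (simp add: m_assoc inv_mult_group)
    finally show ?thesis
      using N_conj_trans[OF y z(3)] z w subgroup.m_closed[OF S_subgroup] by (simp add: class_stabilizer_def)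
  qed
qed

lemma SN_class_stabilizer:
  assumes "y \<in> N" "n \<in> S \<inter> N"
  shows "n \<in> class_stabilizer y"
proof -
  have "n \<otimes> y \<otimes> inv n = y" using SN_central[OF assms(2,1)] assms by (simp add: m_assoc)
  then show ?thesis using assms N_conj_refl by (simp add: class_stabilizer_def)
qed

lemma S_mod_N_linear:
  assumes z: "z \<in> S" and w: "w \<in> S"
  shows "(\<exists>j::nat. inv (z [^] j) \<otimes> w \<in> N) \<or> (\<exists>j::nat. inv (w [^] j) \<otimes> z \<in> N)"
proof -
  interpret q: group_hom G "G Mod N" "\<lambda>x. N #> x" by (rule quotient_hom)
  obtain a where a: "card S = p ^ a" using S_card by blast
  have cc: "c \<in> carrier G" using S_carrier c .
  have ca: "c [^] (p ^ a) = \<one>" using subgroup_pow_card[OF S_subgroup c] a by simp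
  have *: "\<exists>l::nat. inv (z [^] l) \<otimes> w \<in> N"
    if z: "z \<in> S" "inv (c [^] i) \<otimes> z \<in> N" and w: "w \<in> S" "inv (c [^] j) \<otimes> w \<in> N"
      and d: "gcd i (p ^ a) dvd j" for z w and i j :: nat
  proof -
    have zc: "z \<in> carrier G" and wc: "w \<in> carrier G" using z w S_carrier by auto
    obtain l0 where "[i * l0 = gcd i (p ^ a)] (mod p ^ a)" using cong_solve_nat by blast
    moreover obtain t where t: "j = gcd i (p ^ a) * t" using d by (auto elim: dvdE)
    ultimately have "[i * (l0 * t) = j] (mod p ^ a)" by (metis cong_scalar_right mult.assoc)
    then have cj: "c [^] (i * (l0 * t)) = c [^] j" using pow_cong[OF cc ca] by blast
    have "N #> z = N #> (c [^] i)" using rcos_eq_iff[OF nat_pow_closed[OF cc] zc, of i] z(2) by simp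
    then have "N #> (z [^] (l0 * t)) = N #> ((c [^] i) [^] (l0 * t))"
      using q.hom_nat_pow[OF zc, of "l0 * t"] q.hom_nat_pow[OF nat_pow_closed[OF cc, of i], of "l0 * t"] by simp
    also have "\<dots> = N #> (c [^] j)" using cj cc by (simp add: nat_pow_pow)
    also have "\<dots> = N #> w" using rcos_eq_iff[OF nat_pow_closed[OF cc] wc, of j] w(2) by simp
    finally have "inv (z [^] (l0 * t)) \<otimes> w \<in> N"
      using rcos_eq_iff[OF nat_pow_closed[OF zc] wc] by simp
    then show ?thesis by (rule exI)
  qed
  obtain i j :: nat where "inv (c [^] i) \<otimes> z \<in> N" "inv (c [^] j) \<otimes> w \<in> N"
    using S_gen[OF z] S_gen[OF w] by (elim exE)
  then show ?thesis
    using prime_power_gcd_linear[OF p, of i a j] *[OF z _ w] *[OF w _ z] by (elim disjE) simp_all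
qed

text \<open>Both stabilisers contain \<open>S \<inter> N\<close>, and the quotient of \<open>S\<close> by it is a cyclic \<open>p\<close>-group.\<close>

lemma class_stabilizer_linear:
  assumes y: "y \<in> N" and y': "y' \<in> N"
  shows "class_stabilizer y \<subseteq> class_stabilizer y' \<or> class_stabilizer y' \<subseteq> class_stabilizer y"
proof (rule disjCI)
  let ?V = "class_stabilizer y" and ?W = "class_stabilizer y'"
  have V: "subgroup ?V G" and W: "subgroup ?W G" using class_stabilizer_subgroup y y' by auto
  have mem: "w \<in> A" if "w \<in> S" "z \<in> A" "subgroup A G" "S \<inter> N \<subseteq> A" "A \<subseteq> S" "inv (z [^] j) \<otimes> w \<in> N"
    for w z A and j :: nat
  proof -
    have zj: "z [^] j \<in> A" using subgroup_nat_pow_closed that by blast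
    have zc: "z [^] j \<in> carrier G" "w \<in> carrier G" using zj that subgroup.mem_carrier S_carrier by metis+
    have "inv (z [^] j) \<otimes> w \<in> S"
      using zj that by (meson S_subgroup subgroup.m_closed subgroup.m_inv_closed subsetD)
    then have "z [^] j \<otimes> (inv (z [^] j) \<otimes> w) \<in> A" using that zj by (meson IntI subgroup.m_closed subsetD)
    then show ?thesis using zc by (simp add: mult_inv_cancel_left)
  qed
  have sub: "S \<inter> N \<subseteq> ?V" "S \<inter> N \<subseteq> ?W" "?V \<subseteq> S" "?W \<subseteq> S"
    using SN_class_stabilizer y y' by (auto simp: class_stabilizer_def)
  assume "\<not> ?W \<subseteq> ?V"
  then obtain w where w: "w \<in> ?W" "w \<notin> ?V" by blast
  show "?V \<subseteq> ?W"
  proof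
    fix v assume v: "v \<in> ?V"
    have vw: "v \<in> S" "w \<in> S" using v w sub by blast+
    show "v \<in> ?W"
      using S_mod_N_linear[OF vw] mem[OF vw(2) v V sub(1,3)] mem[OF vw(1) w(1) W sub(2,4)] w(2) by blast
  qed
qed

text \<open>The elements \<open>t\<close> of \<open>S\<close> for which \<open>twist t\<close> preserves the \<open>N\<close>-class of \<open>y\<close> form a coset of the
stabiliser of that class.\<close>

lemma class_stabilizer_transfer:
  assumes y: "y \<in> N" and s: "s \<in> S" "N_conj y (twist s y)" and t: "t \<in> S"
  shows "N_conj y (twist t y) \<longleftrightarrow> t \<otimes> inv s \<in> class_stabilizer y"
proof -
  have car: "y \<in> carrier G" "s \<in> carrier G" "t \<in> carrier G" "f y \<in> carrier G"
    using y s t S_carrier f_closed by auto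
  have "N_conj ((t \<otimes> inv s) \<otimes> y \<otimes> inv (t \<otimes> inv s)) ((t \<otimes> inv s) \<otimes> twist s y \<otimes> inv (t \<otimes> inv s))"
    using N_conj_conj[OF car(1) s(2)] car by simp
  also have "(t \<otimes> inv s) \<otimes> twist s y \<otimes> inv (t \<otimes> inv s) = twist t y"
    using car by (simp add: twist_def inv_mult_group m_assoc mult_inv_cancel_left)
  finally have *: "N_conj ((t \<otimes> inv s) \<otimes> y \<otimes> inv (t \<otimes> inv s)) (twist t y)" .
  have "t \<otimes> inv s \<in> S" using s t S_subgroup by (simp add: subgroup.m_closed subgroup.m_inv_closed)
  moreover have "twist t y \<in> carrier G" "(t \<otimes> inv s) \<otimes> y \<otimes> inv (t \<otimes> inv s) \<in> carrier G"
    using car by (simp_all add: twist_def)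
  ultimately show ?thesis
    using * N_conj_trans N_conj_sym car(1) unfolding class_stabilizer_def by (metis (no_types, lifting) mem_Collect_eq)
qed

text \<open>Pairwise intersecting cosets of subgroups in a finite chain have a common element: any element of the
coset of the smallest subgroup will do. The smallest one is found by comparing cardinalities.\<close>

lemma uniform_twist:
  obtains s where "s \<in> S" "\<And>y. y \<in> primary_elements \<Longrightarrow> N_conj y (twist s y)"
proof -
  have fS: "finite S" using S_carrier fin finite_subset by (metis subsetI)
  have "\<one> \<in> primary_elements" using p by (auto simp: primary_elements_def)
  then obtain y0 where y0: "y0 \<in> primary_elements"
    and min: "\<And>y. y \<in> primary_elements \<Longrightarrow> card (class_stabilizer y0) \<le> card (class_stabilizer y)"
    using exists_least_iff[of "\<lambda>n. \<exists>y\<in>primary_elements. card (class_stabilizer y) = n"]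
    by (metis not_le)
  have N: "y \<in> N" if "y \<in> primary_elements" for y using that by (simp add: primary_elements_def)
  have least: "class_stabilizer y0 \<subseteq> class_stabilizer y" if y: "y \<in> primary_elements" for y
  proof -
    have "finite (class_stabilizer y0)" using fS by (simp add: class_stabilizer_def)
    then show ?thesis using class_stabilizer_linear[OF N[OF y] N[OF y0]] min[OF y] card_seteq by blast
  qed
  obtain s where s: "s \<in> S" "N_conj y0 (twist s y0)" using common_twist[OF y0 y0] .
  have "N_conj y (twist s y)" if y: "y \<in> primary_elements" for y
  proof -
    obtain t where t: "t \<in> S" "N_conj y (twist t y)" "N_conj y0 (twist t y0)" using common_twist[OF y y0] .
    have "s \<otimes> inv t \<in> class_stabilizer y0"
      using class_stabilizer_transfer[OF N[OF y0] t(1,3) s(1)] s(2) by blast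
    then show ?thesis using least[OF y] class_stabilizer_transfer[OF N[OF y] t(1,2) s(1)] by blast
  qed
  then show ?thesis using that s(1) by blast
qed

text \<open>Modulo \<open>S \<inter> N\<close>, which is contained in all stabilisers, \<open>s\<close> is a power of the generator \<open>c\<close>.\<close>

lemma uniform_twist_power:
  obtains j :: nat where "\<And>y. y \<in> primary_elements \<Longrightarrow> N_conj y (twist (c [^] j) y)"
proof -
  obtain s where s: "s \<in> S" "\<And>y. y \<in> primary_elements \<Longrightarrow> N_conj y (twist s y)" using uniform_twist by blast
  obtain j :: nat where j: "inv (c [^] j) \<otimes> s \<in> N" using S_gen[OF s(1)] by blast
  have cS: "c [^] j \<in> S" using subgroup_nat_pow_closed[OF S_subgroup c] .
  have car: "c [^] j \<in> carrier G" "s \<in> carrier G" using cS s S_carrier by auto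
  have inS: "inv s \<otimes> c [^] j \<in> S \<inter> N" 
  proof -
    have "inv (inv (c [^] j) \<otimes> s) \<in> N" using j by simp
    moreover have "inv s \<otimes> c [^] j \<in> S" using cS s S_subgroup by (simp add: subgroup.m_closed subgroup.m_inv_closed)
    ultimately show ?thesis using car by (simp add: inv_mult_group)
  qed
  have "N_conj y (twist (c [^] j) y)" if y: "y \<in> primary_elements" for y
  proof -
    have yN: "y \<in> N" using y by (simp add: primary_elements_def)
    have "s \<otimes> (inv s \<otimes> c [^] j) \<otimes> inv s \<in> S \<inter> N"
      using inv_op_closed2[OF car(2)] inS s S_subgroup by (simp add: subgroup.m_closed subgroup.m_inv_closed)
    also have "s \<otimes> (inv s \<otimes> c [^] j) \<otimes> inv s = c [^] j \<otimes> inv s" using car by (simp add: mult_inv_cancel_left)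
    finally show ?thesis
      using class_stabilizer_transfer[OF yN s(1) s(2)[OF y] cS] SN_class_stabilizer[OF yN] by blast
  qed
  then show ?thesis using that by blast
qed

text \<open>For \<open>q\<close> different from \<open>p\<close> the coprimality lemma is applied inside \<open>N\<close> to its Sylow \<open>q\<close>-subgroup; this is
invariant under \<open>twist s\<close>, as it consists of all \<open>q\<close>-elements. For \<open>q = p\<close> the class of \<open>y\<close> is a
single element.\<close>

lemma twist_fixes_primary:
  assumes s: "s \<in> S" and cl: "\<And>y. y \<in> primary_elements \<Longrightarrow> N_conj y (twist s y)"
    and q: "Factorial_Ring.prime (q::nat)" and y: "y \<in> N" "y [^] (q ^ j) = \<one>"
  shows "twist s y = y"
proof -
  have yc: "y \<in> carrier G" using y by simp
  interpret t: group_hom G G "twist s" using twist_hom[OF s] by unfold_locales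
  interpret K: group K by (rule group_K)
  show ?thesis
  proof (cases "q = p")
    case True
    then have "y \<in> S \<inter> N" using p_elements_of_N y by blast
    moreover obtain n where n: "n \<in> N" "twist s y = inv n \<otimes> y \<otimes> n"
      using cl[of y] q y by (auto simp: primary_elements_def N_conj_def)
    ultimately show ?thesis using SN_central[of y n] yc by (simp add: m_assoc mult_inv_cancel_left)
  next
    case False
    obtain R where R: "sylow_subgroup K q R" using K.sylow_subgroup_exists[OF finite_K q] .
    then have RK: "subgroup R K" "card R = q ^ multiplicity q (order K)" by (auto simp: sylow_subgroup_def)
    define b where "b = multiplicity q (order K)"
    have Rel: "x \<in> N \<and> x [^] (q ^ b) = \<one>" if "x \<in> R" for x
      using K.subgroup_pow_card[OF RK(1) that] subgroup.mem_carrier[OF RK(1) that] RK(2) K_pow by (simp add: b_def)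
    have RI: "x \<in> R" if "x \<in> N" "x [^] (q ^ i) = \<one>" for x i
      using nilpotent_sylow_contains[OF nilN finite_K q R, of x i] that K_pow by simp
    obtain l where l: "\<And>y. y \<in> carrier G \<Longrightarrow> (twist s ^^ (p ^ l)) y = y" using twist_period s by metis
    obtain L n where L: "central_chain K L n" "L n = {\<one>\<^bsub>K\<^esub>}" using nilpotent_central_chain[OF nilN] .
    have "inv\<^bsub>K\<^esub> y \<otimes>\<^bsub>K\<^esub> twist s y \<in> L n"
    proof (rule K.coprime_automorphism_mod_chain[OF L(1) _ RK(1), of "twist s" "p ^ l" "q ^ j" y])
      show "twist s \<in> hom K K" using twist_N[OF s] by (auto simp: hom_def)
      show "twist s x \<in> R" if "x \<in> R" for x
      proof (rule RI)
        show "twist s x \<in> N" using twist_N[OF s] Rel[OF that] by blast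
        show "twist s x [^] (q ^ b) = \<one>" using Rel[OF that] t.hom_nat_pow[of x "q ^ b"] by simp
      qed
      show "\<exists>u\<in>carrier K. twist s x = inv\<^bsub>K\<^esub> u \<otimes>\<^bsub>K\<^esub> x \<otimes>\<^bsub>K\<^esub> u" if "x \<in> R" for x
      proof -
        have "x \<in> primary_elements" using Rel[OF that] q by (auto simp: primary_elements_def)
        then obtain n where "n \<in> N" "twist s x = inv n \<otimes> x \<otimes> n" using cl by (auto simp: N_conj_def)
        then show ?thesis using K_inv by auto
      qed
      show "(twist s ^^ (p ^ l)) x = x" if "x \<in> R" for x using l Rel[OF that] by simp
      show "coprime (p ^ l) (q ^ j)" using primes_coprime[OF p q] False by simp
      show "y \<in> R" using RI y by blast
      show "y [^]\<^bsub>K\<^esub> (q ^ j) \<in> L n" using y K_pow L(2) by simp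
    qed
    then have "inv y \<otimes> twist s y = \<one>" using L(2) K_inv[OF y(1)] by simp
    then have "y \<otimes> (inv y \<otimes> twist s y) = y" using yc by simp
    then show ?thesis using yc by (simp add: mult_inv_cancel_left)
  qed
qed

lemma f_inner:
  obtains b where "b \<in> carrier G" "\<And>g. g \<in> carrier G \<Longrightarrow> f g = inv b \<otimes> g \<otimes> b"
proof -
  \<comment> \<open>Taking \<open>s\<close> among the powers of \<open>c\<close> makes it commute with \<open>c\<close>, which together with \<open>S \<inter> N\<close> generates \<open>S\<close>.\<close>
  obtain j :: nat where j: "\<And>y. y \<in> primary_elements \<Longrightarrow> N_conj y (twist (c [^] j) y)"
    using uniform_twist_power by blast
  define s where "s = c [^] j"
  have cc: "c \<in> carrier G" using S_carrier c .
  have s: "s \<in> S" unfolding s_def using subgroup_nat_pow_closed[OF S_subgroup c] .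
  have sc: "s \<in> carrier G" using S_carrier s .
  interpret t: group_hom G G "twist s" using twist_hom[OF s] by unfold_locales
  interpret K: group K by (rule group_K)
  define H where "H = {n \<in> N. twist s n = n}"
  have "subgroup H K"
  proof (rule K.subgroupI)
    show "H \<subseteq> carrier K" by (auto simp: H_def)
    have "\<one> \<in> H" by (simp add: H_def)
    then show "H \<noteq> {}" by blast
    show "inv\<^bsub>K\<^esub> n \<in> H" if "n \<in> H" for n using that K_inv[of n] by (simp add: H_def)
    show "m \<otimes>\<^bsub>K\<^esub> n \<in> H" if "m \<in> H" "n \<in> H" for m n using that by (simp add: H_def)
  qed
  then have "H = N"
  proof (rule N_eqI)
    fix q i x assume "Factorial_Ring.prime (q::nat)" "x \<in> N" "x [^] (q ^ i) = \<one>"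
    then show "x \<in> H" using twist_fixes_primary[OF s, of q x i] j unfolding s_def[symmetric] by (simp add: H_def)
  qed
  then have tN: "twist s n = n" if "n \<in> N" for n using that by (auto simp: H_def)
  have s_comm: "s \<otimes> z = z \<otimes> s" if z: "z \<in> S" for z
  proof -
    have zc: "z \<in> carrier G" using S_carrier z .
    obtain i :: nat where i: "inv (c [^] i) \<otimes> z \<in> N" using S_gen[OF z] by blast
    define n where "n = inv (c [^] i) \<otimes> z"
    have n: "n \<in> N" "n \<in> S" "n \<in> carrier G"
      using i z subgroup_nat_pow_closed[OF S_subgroup c, of i] S_subgroup cc zc
      by (auto simp: n_def subgroup.m_closed subgroup.m_inv_closed)
    have "s \<otimes> n \<otimes> inv s = n" using tN[OF n(1)] fS[OF n(2)] by (simp add: twist_def)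
    then have "s \<otimes> n = n \<otimes> s" using sc n by (metis inv_solve_right' m_closed)
    moreover have "s \<otimes> c [^] i = c [^] i \<otimes> s" unfolding s_def using cc by (simp add: nat_pow_mult add.commute)
    ultimately have "s \<otimes> (c [^] i \<otimes> n) = (c [^] i \<otimes> n) \<otimes> s" using commute_mult sc n(3) cc by simp
    then show ?thesis using zc cc by (simp add: n_def mult_inv_cancel_left)
  qed
  have tS: "twist s z = z" if z: "z \<in> S" for z
    using s_comm[OF z] fS[OF z] S_carrier[OF z] sc by (simp add: twist_def m_assoc)
  obtain l where l: "\<And>y. y \<in> carrier G \<Longrightarrow> (twist s ^^ (p ^ l)) y = y" using twist_period s by metis
  obtain b where b: "b \<in> carrier G" "\<And>g. g \<in> carrier G \<Longrightarrow> twist s g = inv b \<otimes> g \<otimes> b"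
    using inner_if_trivial_on_sylow[OF fin p normal_axioms S_subgroup
      coprime_sylow_index[OF fin p S] twist_hom[OF s] tN tS twist_mod_N[OF s] l]
    by blast
  have "f g = inv (b \<otimes> s) \<otimes> g \<otimes> (b \<otimes> s)" if g: "g \<in> carrier G" for g
  proof -
    have "f g = inv s \<otimes> twist s g \<otimes> s" using f_closed[OF g] sc by (simp add: twist_def m_assoc mult_inv_cancel_left)
    then show ?thesis using b g sc by (simp add: m_assoc inv_mult_group)
  qed
  then show ?thesis using that b(1) sc by blast
qed

end

section \<open>The theorem\<close>

theorem theorem4p4:
  fixes G :: "('a, 'b) monoid_scheme" and N P :: "'a set" and Q :: "'a set set"
    and p :: nat and \<sigma> :: "'a \<Rightarrow> 'a"
  assumes "Factorial_Ring.prime p"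
    and "group G" and "finite (carrier G)"
    and "N \<lhd> G" and "nilpotent_group (G\<lparr>carrier := N\<rparr>)"
    and "nilpotent_group (G Mod N)"
    and "sylow_subgroup (G\<lparr>carrier := N\<rparr>) p P" and "comm_group (G\<lparr>carrier := P\<rparr>)"
    and "sylow_subgroup (G Mod N) p Q" and "cyclic_group ((G Mod N)\<lparr>carrier := Q\<rparr>)"
    and "\<sigma> \<in> auto G" and "\<exists>k. group.ord (AutoGroup G) \<sigma> = p ^ k"
    and "class_preserving_automorphism G \<sigma>" and "coleman_automorphism G \<sigma>"
  shows "inner_automorphism G \<sigma>"
proof -
  note p = assms(1) and fin = assms(3) and nilN = assms(5) and nilQ = assms(6)
  interpret group G by (rule assms(2))
  interpret N: normal N G by (rule assms(4))
  interpret q: group_hom G "G Mod N" "\<lambda>x. N #>\<^bsub>G\<^esub> x" by (rule N.quotient_hom)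
  have \<sigma>: "\<sigma> \<in> hom G G" and ext: "\<sigma> \<in> extensional (carrier G)"
    using assms(11) by (auto simp: auto_def Bij_def)
  have \<sigma>c: "\<sigma> x \<in> carrier G" if "x \<in> carrier G" for x using that \<sigma> by (auto simp: hom_def)
  obtain k where "group.ord (AutoGroup G) \<sigma> = p ^ k" using assms(12) by blast
  then have per: "(\<sigma> ^^ (p ^ k)) x = x" if "x \<in> carrier G" for x
    using funpow_ord_automorphism[OF assms(11) that] by simp
  have col: "\<exists>g\<in>carrier G. \<forall>x\<in>R. \<sigma> x = inv\<^bsub>G\<^esub> g \<otimes>\<^bsub>G\<^esub> x \<otimes>\<^bsub>G\<^esub> g"
    if l: "Factorial_Ring.prime l" and R: "sylow_subgroup G l R" for l R
  proof (cases "l dvd order G")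
    case True
    have sub: "R \<subseteq> carrier G" using R subgroup.subset by (auto simp: sylow_subgroup_def)
    obtain g where g: "g \<in> carrier G" "restrict \<sigma> R = restrict (conj_map G g) R"
      using assms(14) l R True by (auto simp: coleman_automorphism_def)
    have "\<sigma> x = inv\<^bsub>G\<^esub> g \<otimes>\<^bsub>G\<^esub> x \<otimes>\<^bsub>G\<^esub> g" if "x \<in> R" for x
      using fun_cong[OF g(2), of x] that sub by (auto simp: conj_map_def)
    then show ?thesis using g(1) by blast
  next
    case False
    then have "card R = 1" "subgroup R G" using R by (auto simp: sylow_subgroup_def not_dvd_imp_multiplicity_0)
    then have "R = {\<one>\<^bsub>G\<^esub>}" using subgroup.one_closed by (metis card_1_singletonE singletonD)
    moreover have "\<sigma> \<one>\<^bsub>G\<^esub> = \<one>\<^bsub>G\<^esub>" using hom_one[OF \<sigma> is_group is_group] .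
    ultimately show ?thesis by (intro bexI[of _ "\<one>\<^bsub>G\<^esub>"]) auto
  qed
  obtain S where S: "sylow_subgroup G p S" using sylow_subgroup_exists[OF fin p] .
  then have Ssub: "subgroup S G" by (simp add: sylow_subgroup_def)
  have Sc: "x \<in> carrier G" if "x \<in> S" for x using subgroup.mem_carrier[OF Ssub that] .
  obtain g where g: "g \<in> carrier G" "\<And>x. x \<in> S \<Longrightarrow> \<sigma> x = inv\<^bsub>G\<^esub> g \<otimes>\<^bsub>G\<^esub> x \<otimes>\<^bsub>G\<^esub> g"
    using col[OF p S] by blast
  obtain w l where w: "w \<in> carrier G" "\<And>x. x \<in> S \<Longrightarrow> w \<otimes>\<^bsub>G\<^esub> \<sigma> x \<otimes>\<^bsub>G\<^esub> inv\<^bsub>G\<^esub> w = x"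
    "\<And>x. x \<in> carrier G \<Longrightarrow> ((\<lambda>x. w \<otimes>\<^bsub>G\<^esub> \<sigma> x \<otimes>\<^bsub>G\<^esub> inv\<^bsub>G\<^esub> w) ^^ (p ^ l)) x = x"
    using normalise_on_subgroup[OF fin p \<sigma> per _ g] subgroup.subset[OF Ssub] by metis
  define f where "f = (\<lambda>x. w \<otimes>\<^bsub>G\<^esub> \<sigma> x \<otimes>\<^bsub>G\<^esub> inv\<^bsub>G\<^esub> w)"
  \<comment> \<open>Whatever \<open>\<sigma>\<close> does by conjugation, \<open>f\<close> does by conjugation with a shifted element.\<close>
  have conj: "f x = inv\<^bsub>G\<^esub> (u \<otimes>\<^bsub>G\<^esub> inv\<^bsub>G\<^esub> w) \<otimes>\<^bsub>G\<^esub> x \<otimes>\<^bsub>G\<^esub> (u \<otimes>\<^bsub>G\<^esub> inv\<^bsub>G\<^esub> w)"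
    if "u \<in> carrier G" "x \<in> carrier G" "\<sigma> x = inv\<^bsub>G\<^esub> u \<otimes>\<^bsub>G\<^esub> x \<otimes>\<^bsub>G\<^esub> u" for u x
    using that w(1) by (simp add: f_def inv_mult_group m_assoc)
  obtain a where a: "card S = p ^ a" using S by (auto simp: sylow_subgroup_def)
  have finN: "finite (carrier (G\<lparr>carrier := N\<rparr>))" using fin N.subset finite_subset by auto
  have finQ: "finite (carrier (G Mod N))" using fin by (simp add: FactGroup_def RCOSETS_def)
  have SN_P: "x \<in> P" if x: "x \<in> S \<inter> N" for x
    using nilpotent_sylow_contains[OF nilN finN p assms(7), of x a] x subgroup_pow_card[OF Ssub, of x] a
    by (simp add: nat_pow_consistent[symmetric])
  have SQ: "(N #>\<^bsub>G\<^esub> z) \<in> Q" if z: "z \<in> S" for z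
  proof (rule nilpotent_sylow_contains[OF nilQ finQ p assms(9), of _ a])
    show "N #>\<^bsub>G\<^esub> z \<in> carrier (G Mod N)" using q.hom_closed[OF Sc[OF z]] .
    show "(N #>\<^bsub>G\<^esub> z) [^]\<^bsub>G Mod N\<^esub> (p ^ a) = \<one>\<^bsub>G Mod N\<^esub>"
      using q.hom_nat_pow[OF Sc[OF z], of "p ^ a"] subgroup_pow_card[OF Ssub z] a q.hom_one by simp
  qed
  have Qsub: "subgroup Q (G Mod N)" and Qcard: "card Q = p ^ multiplicity p (order (G Mod N))"
    using assms(9) by (auto simp: sylow_subgroup_def)
  interpret Q: group "(G Mod N)\<lparr>carrier := Q\<rparr>" using q.H.subgroup_imp_group[OF Qsub] .
  obtain y where y: "y \<in> Q" "Q = range (\<lambda>n::int. y [^]\<^bsub>(G Mod N)\<lparr>carrier := Q\<rparr>\<^esub> n)"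
    using assms(10) Q.cyclic_group by auto
  have yc: "y \<in> carrier (G Mod N)" using subgroup.mem_carrier[OF Qsub y(1)] .
  have "y \<in> (\<lambda>x. N #>\<^bsub>G\<^esub> x) ` S"
    using nilpotent_sylow_contains[OF nilQ finQ p N.sylow_inter_image(2)[OF fin p S] yc]
      q.H.subgroup_pow_card[OF Qsub y(1)] Qcard by simp
  then obtain c where c: "c \<in> S" "y = N #>\<^bsub>G\<^esub> c" by (elim imageE)
  have gen: "\<exists>j::nat. inv\<^bsub>G\<^esub> (c [^]\<^bsub>G\<^esub> j) \<otimes>\<^bsub>G\<^esub> z \<in> N" if z: "z \<in> S" for z
  proof -
    obtain i :: int where i: "N #>\<^bsub>G\<^esub> z = y [^]\<^bsub>(G Mod N)\<lparr>carrier := Q\<rparr>\<^esub> i" using SQ[OF z] y(2) by auto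
    have "finite (carrier ((G Mod N)\<lparr>carrier := Q\<rparr>))" using finQ subgroup.subset[OF Qsub] finite_subset by auto
    then obtain j :: nat where "y [^]\<^bsub>(G Mod N)\<lparr>carrier := Q\<rparr>\<^esub> i = y [^]\<^bsub>(G Mod N)\<lparr>carrier := Q\<rparr>\<^esub> j"
      using Q.int_pow_eq_nat_pow[of y i] y(1) by auto
    then have "N #>\<^bsub>G\<^esub> z = y [^]\<^bsub>G Mod N\<^esub> j" using i by (simp add: q.H.nat_pow_consistent[symmetric])
    then have "N #>\<^bsub>G\<^esub> (c [^]\<^bsub>G\<^esub> j) = N #>\<^bsub>G\<^esub> z" using q.hom_nat_pow[OF Sc[OF c(1)], of j] c(2) by simp
    then show ?thesis
      using iffD1[OF N.rcos_eq_iff[OF nat_pow_closed[OF Sc[OF c(1)]] Sc[OF z]]] by (intro exI)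
  qed
  interpret sylow_fixing_automorphism N G p S c f l
  proof unfold_locales
    show "x \<otimes>\<^bsub>G\<^esub> z = z \<otimes>\<^bsub>G\<^esub> x" if "x \<in> S \<inter> N" "z \<in> S \<inter> N" for x z
      using comm_groupE(4)[OF assms(8), of x z] SN_P that by simp
    show "\<exists>u\<in>carrier G. f x = inv\<^bsub>G\<^esub> u \<otimes>\<^bsub>G\<^esub> x \<otimes>\<^bsub>G\<^esub> u" if xc: "x \<in> carrier G" for x
    proof -
      obtain u where "u \<in> carrier G" "\<sigma> x = inv\<^bsub>G\<^esub> u \<otimes>\<^bsub>G\<^esub> x \<otimes>\<^bsub>G\<^esub> u"
        using assms(13) xc by (auto simp: class_preserving_automorphism_def)
      then show ?thesis using conj xc w(1) by (intro bexI[of _ "u \<otimes>\<^bsub>G\<^esub> inv\<^bsub>G\<^esub> w"]) auto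
    qed
    show "\<exists>u\<in>carrier G. \<forall>x\<in>R. f x = inv\<^bsub>G\<^esub> u \<otimes>\<^bsub>G\<^esub> x \<otimes>\<^bsub>G\<^esub> u"
      if qR: "Factorial_Ring.prime q" "sylow_subgroup G q R" for q R
    proof -
      obtain u where "u \<in> carrier G" "\<And>x. x \<in> R \<Longrightarrow> \<sigma> x = inv\<^bsub>G\<^esub> u \<otimes>\<^bsub>G\<^esub> x \<otimes>\<^bsub>G\<^esub> u"
        using col[OF qR] by blast
      moreover have "x \<in> carrier G" if "x \<in> R" for x
        using qR(2) that subgroup.mem_carrier by (auto simp: sylow_subgroup_def)
      ultimately show ?thesis using conj w(1) by (intro bexI[of _ "u \<otimes>\<^bsub>G\<^esub> inv\<^bsub>G\<^esub> w"]) auto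
    qed
    show "f \<in> hom G G" unfolding f_def by (rule conj_hom[OF \<sigma> w(1)])
    show "f z = z" if "z \<in> S" for z using w(2)[OF that] by (simp add: f_def)
    show "(f ^^ p ^ l) x = x" if "x \<in> carrier G" for x using w(3)[OF that] by (simp add: f_def)
  qed (fact p fin nilN nilQ S c(1) gen)+
  obtain b where b: "b \<in> carrier G" "\<And>g. g \<in> carrier G \<Longrightarrow> f g = inv\<^bsub>G\<^esub> b \<otimes>\<^bsub>G\<^esub> g \<otimes>\<^bsub>G\<^esub> b"
    using f_inner by blast
  have "\<sigma> x = conj_map G (b \<otimes>\<^bsub>G\<^esub> w) x" for x
  proof (cases "x \<in> carrier G")
    case True
    have "\<sigma> x = inv\<^bsub>G\<^esub> w \<otimes>\<^bsub>G\<^esub> f x \<otimes>\<^bsub>G\<^esub> w"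
      using \<sigma>c[OF True] w(1) by (simp add: f_def m_assoc mult_inv_cancel_left)
    then show ?thesis using b True w(1) by (simp add: conj_map_def m_assoc inv_mult_group)
  next
    case False
    then show ?thesis using ext by (simp add: conj_map_def extensional_def)
  qed
  then show ?thesis unfolding inner_automorphism_def using b(1) w(1) by blast
qed

end
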